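(* The category $\mathbf{FCov}$ of formal covers and formal cover maps is impredicatively dual to (i.e. equivalent to the opposite of) the category $\mathbf{Frm}$ of frames, and (impredicatively) equivalent to the category $\mathbf{Loc}$ of locales.
   Context: A basic cover $(S,\lhd)$ on a set $S$ is a relation $\lhd$ between elements and subsets of $S$ such that $a\in U$ implies $a\lhd U$, and $a\lhd U$, $U\lhd V$ imply $a\lhd V$, where $U\lhd V$ means $b\lhd V$ for all $b\in U$. Put $\mathcal A U=\{a\in S\mid a\lhd U\}$; $U=_{\mathcal A}V$ means $\mathcal A U=\mathcal A V$. $Sat(\mathcal A)=\{U\subseteq S\mid U=\mathcal A U\}$ has joins $\bigvee^{\mathcal A}_i\mathcal A U_i=\mathcal A(\bigcup_iU_i)$. Elements are identified with singletons. For a relation $r$ between $S$ and $T$ and $V\subseteq T$, $r^-V=\{a\in S\mid\exists b\in V,\ a\,r\,b\}$. A basic cover map $r:(S,\lhd_S)\to(T,\lhd_T)$ is a relation between $S$ and $T$ such that $b\lhd_TV$ implies $r^-b\lhd_Sr^-V$; two are equal if $r_1^-b=_{\mathcal A_S}r_2^-b$ for all $b\in T$; composition is relational composition. A convergent cover is $(S,\lhd,\circ)$ where $\lhd$ is a basic cover on $S$ and $\circ$ is a binary operation on $\mathcal P(S)$ such that: $U_1\lhd V_1$ and $U_2\lhd V_2$ imply $U_1\circ U_2\lhd V_1\circ V_2$; $(U\circ V)\circ W\lhd U\circ(V\circ W)$; $U\circ V\lhd V\circ U$; and the operation $\mathcal A U\circ^{\mathcal A}\mathcal A V=\mathcal A(U\circ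 V)$ on $Sat(\mathcal A)$ distributes over arbitrary joins. A formal cover is a convergent cover with $\mathcal A(U\circ V)=\mathcal A U\cap\mathcal A V$ for all $U,V\subseteq S$ (then $S$ is a unit for $\circ$). A formal cover map $r:(S,\lhd_S,\circ_S)\to(T,\lhd_T,\circ_T)$ is a basic cover map with $r^-(b_1\circ_Tb_2)=_{\mathcal A_S}(r^-b_1)\circ_S(r^-b_2)$ for all $b_1,b_2\in T$ (where $b_1\circ_T b_2=\{b_1\}\circ_T\{b_2\}$) and $r^-T=_{\mathcal A_S}S$; equality is equality of basic cover maps. $\mathbf{Frm}$: suplattices in which binary meets distribute over arbitrary joins, with maps preserving arbitrary joins and finite meets (including top). $\mathbf{Loc}=\mathbf{Frm}^{op}$. "Impredicatively" means in a foundation where powersets of sets are sets. *)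

theory Defs
  imports "HOL-Algebra.Complete_Lattice" "HOL-Library.Equipollence"
begin

section \<open>Categories\<close>

text \<open>
  Hom-sets are families indexed by pairs of objects. They need not be pairwise disjoint, so
  composition carries its three objects as arguments: \<open>cmp C X Y Z g f\<close> is
  \<open>g\<close> after \<open>f\<close>, for \<open>f : X \<rightarrow> Y\<close> and \<open>g : Y \<rightarrow> Z\<close>.
\<close>

record ('o, 'm) cat =
  obj :: "'o set"
  hom_set :: "'o \<Rightarrow> 'o \<Rightarrow> 'm set"
  cmp :: "'o \<Rightarrow> 'o \<Rightarrow> 'o \<Rightarrow> 'm \<Rightarrow> 'm \<Rightarrow> 'm"
  idt :: "'o \<Rightarrow> 'm"

locale category =
  fixes C :: "('o, 'm) cat"
  assumes idt_closed: "X \<in> obj C \<Longrightarrow> idt C X \<in> hom_set C X X"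
    and cmp_closed:
      "\<lbrakk>X \<in> obj C; Y \<in> obj C; Z \<in> obj C; f \<in> hom_set C X Y; g \<in> hom_set C Y Z\<rbrakk>
       \<Longrightarrow> cmp C X Y Z g f \<in> hom_set C X Z"
    and cmp_idt_right:
      "\<lbrakk>X \<in> obj C; Y \<in> obj C; f \<in> hom_set C X Y\<rbrakk> \<Longrightarrow> cmp C X X Y f (idt C X) = f"
    and cmp_idt_left:
      "\<lbrakk>X \<in> obj C; Y \<in> obj C; f \<in> hom_set C X Y\<rbrakk> \<Longrightarrow> cmp C X Y Y (idt C Y) f = f"
    and cmp_assoc:
      "\<lbrakk>W \<in> obj C; X \<in> obj C; Y \<in> obj C; Z \<in> obj C;
        f \<in> hom_set C W X; g \<in> hom_set C X Y; h \<in> hom_set C Y Z\<rbrakk>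
       \<Longrightarrow> cmp C W Y Z h (cmp C W X Y g f) = cmp C W X Z (cmp C X Y Z h g) f"

definition opposite :: "('o, 'm) cat \<Rightarrow> ('o, 'm) cat" where
  "opposite C =
     \<lparr>obj = obj C,
      hom_set = (\<lambda>X Y. hom_set C Y X),
      cmp = (\<lambda>X Y Z g f. cmp C Z Y X f g),
      idt = idt C\<rparr>"

definition isomorphism :: "('o, 'm) cat \<Rightarrow> 'o \<Rightarrow> 'o \<Rightarrow> 'm \<Rightarrow> bool" where
  "isomorphism C X Y f \<longleftrightarrow>
     f \<in> hom_set C X Y \<and>
     (\<exists>g \<in> hom_set C Y X. cmp C X Y X g f = idt C X \<and> cmp C Y X Y f g = idt C Y)"

record ('o1, 'm1, 'o2, 'm2) ftor =
  on_obj :: "'o1 \<Rightarrow> 'o2"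
  on_hom :: "'o1 \<Rightarrow> 'o1 \<Rightarrow> 'm1 \<Rightarrow> 'm2"

locale cat_functor = source: category C + target: category D
  for C :: "('o1, 'm1) cat" and D :: "('o2, 'm2) cat" +
  fixes F :: "('o1, 'm1, 'o2, 'm2) ftor"
  assumes on_obj_closed: "X \<in> obj C \<Longrightarrow> on_obj F X \<in> obj D"
    and on_hom_closed:
      "\<lbrakk>X \<in> obj C; Y \<in> obj C; f \<in> hom_set C X Y\<rbrakk>
       \<Longrightarrow> on_hom F X Y f \<in> hom_set D (on_obj F X) (on_obj F Y)"
    and on_hom_idt: "X \<in> obj C \<Longrightarrow> on_hom F X X (idt C X) = idt D (on_obj F X)"
    and on_hom_cmp:
      "\<lbrakk>X \<in> obj C; Y \<in> obj C; Z \<in> obj C; f \<in> hom_set C X Y; g \<in> hom_set C Y Z\<rbrakk>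
       \<Longrightarrow> on_hom F X Z (cmp C X Y Z g f) =
           cmp D (on_obj F X) (on_obj F Y) (on_obj F Z) (on_hom F Y Z g) (on_hom F X Y f)"

definition id_ftor :: "('o, 'm, 'o, 'm) ftor" where
  "id_ftor = \<lparr>on_obj = (\<lambda>X. X), on_hom = (\<lambda>X Y f. f)\<rparr>"

definition comp_ftor ::
  "('o2, 'm2, 'o3, 'm3) ftor \<Rightarrow> ('o1, 'm1, 'o2, 'm2) ftor \<Rightarrow> ('o1, 'm1, 'o3, 'm3) ftor" where
  "comp_ftor G F =
     \<lparr>on_obj = (\<lambda>X. on_obj G (on_obj F X)),
      on_hom = (\<lambda>X Y f. on_hom G (on_obj F X) (on_obj F Y) (on_hom F X Y f))\<rparr>"

definition naturally_isomorphic ::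
  "('o1, 'm1) cat \<Rightarrow> ('o2, 'm2) cat \<Rightarrow>
   ('o1, 'm1, 'o2, 'm2) ftor \<Rightarrow> ('o1, 'm1, 'o2, 'm2) ftor \<Rightarrow> bool" where
  "naturally_isomorphic C D F G \<longleftrightarrow>
     (\<exists>\<eta>. (\<forall>X \<in> obj C. isomorphism D (on_obj F X) (on_obj G X) (\<eta> X)) \<and>
          (\<forall>X \<in> obj C. \<forall>Y \<in> obj C. \<forall>f \<in> hom_set C X Y.
             cmp D (on_obj F X) (on_obj F Y) (on_obj G Y) (\<eta> Y) (on_hom F X Y f) =
             cmp D (on_obj F X) (on_obj G X) (on_obj G Y) (on_hom G X Y f) (\<eta> X)))"

definition equivalent_categories :: "('o1, 'm1) cat \<Rightarrow> ('o2, 'm2) cat \<Rightarrow> bool" where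
  "equivalent_categories C D \<longleftrightarrow>
     (\<exists>F G. cat_functor C D F \<and> cat_functor D C G \<and>
        naturally_isomorphic C C id_ftor (comp_ftor G F) \<and>
        naturally_isomorphic D D (comp_ftor F G) id_ftor)"

definition dual_categories :: "('o1, 'm1) cat \<Rightarrow> ('o2, 'm2) cat \<Rightarrow> bool" where
  "dual_categories C D \<longleftrightarrow> equivalent_categories C (opposite D)"


section \<open>Basic, convergent and formal covers\<close>

record 'a cover_struct = "'a partial_object" +
  cov :: "'a \<Rightarrow> 'a set \<Rightarrow> bool" (infix \<open>\<lhd>\<index>\<close> 50)

record 'a conv_struct = "'a cover_struct" +
  conv :: "'a set \<Rightarrow> 'a set \<Rightarrow> 'a set" (infixl \<open>\<odot>\<index>\<close> 70)

definition set_cov :: "('a, 'x) cover_struct_scheme \<Rightarrow> 'a set \<Rightarrow> 'a set \<Rightarrow> bool" where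
  "set_cov S U V \<longleftrightarrow> (\<forall>b \<in> U. b \<lhd>\<^bsub>S\<^esub> V)"

definition saturation :: "('a, 'x) cover_struct_scheme \<Rightarrow> 'a set \<Rightarrow> 'a set" where
  "saturation S U = {a \<in> carrier S. a \<lhd>\<^bsub>S\<^esub> U}"

definition Sat :: "('a, 'x) cover_struct_scheme \<Rightarrow> 'a set set" where
  "Sat S = {U. U \<subseteq> carrier S \<and> U = saturation S U}"

definition sat_Join :: "('a, 'x) cover_struct_scheme \<Rightarrow> 'a set set \<Rightarrow> 'a set" where
  "sat_Join S \<V> = saturation S (\<Union>\<V>)"

text \<open>
  The operation induced on saturated subsets, evaluated at \<open>U = saturation S U\<close> and
  \<open>V = saturation S V\<close>.
\<close>

definition sat_conv :: "('a, 'x) conv_struct_scheme \<Rightarrow> 'a set \<Rightarrow> 'a set \<Rightarrow> 'a set" where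
  "sat_conv S U V = saturation S (U \<odot>\<^bsub>S\<^esub> V)"

locale basic_cover =
  fixes S :: "('a, 'x) cover_struct_scheme" (structure)
  assumes cov_between: "a \<lhd> U \<Longrightarrow> a \<in> carrier S \<and> U \<subseteq> carrier S"
    and cov_refl: "\<lbrakk>U \<subseteq> carrier S; a \<in> U\<rbrakk> \<Longrightarrow> a \<lhd> U"
    and cov_trans:
      "\<lbrakk>U \<subseteq> carrier S; V \<subseteq> carrier S; a \<lhd> U; set_cov S U V\<rbrakk> \<Longrightarrow> a \<lhd> V"

locale convergent_cover = basic_cover S
  for S :: "('a, 'x) conv_struct_scheme" (structure) +
  assumes conv_closed: "\<lbrakk>U \<subseteq> carrier S; V \<subseteq> carrier S\<rbrakk> \<Longrightarrow> U \<odot> V \<subseteq> carrier S"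
    and conv_stable:
      "\<lbrakk>U\<^sub>1 \<subseteq> carrier S; V\<^sub>1 \<subseteq> carrier S; U\<^sub>2 \<subseteq> carrier S; V\<^sub>2 \<subseteq> carrier S;
        set_cov S U\<^sub>1 V\<^sub>1; set_cov S U\<^sub>2 V\<^sub>2\<rbrakk> \<Longrightarrow> set_cov S (U\<^sub>1 \<odot> U\<^sub>2) (V\<^sub>1 \<odot> V\<^sub>2)"
    and conv_assoc:
      "\<lbrakk>U \<subseteq> carrier S; V \<subseteq> carrier S; W \<subseteq> carrier S\<rbrakk>
       \<Longrightarrow> set_cov S ((U \<odot> V) \<odot> W) (U \<odot> (V \<odot> W))"
    and conv_commute:
      "\<lbrakk>U \<subseteq> carrier S; V \<subseteq> carrier S\<rbrakk> \<Longrightarrow> set_cov S (U \<odot> V) (V \<odot> U)"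
    and sat_conv_distrib_left:
      "\<lbrakk>U \<in> Sat S; \<V> \<subseteq> Sat S\<rbrakk>
       \<Longrightarrow> sat_conv S U (sat_Join S \<V>) = sat_Join S ((\<lambda>V. sat_conv S U V) ` \<V>)"
    and sat_conv_distrib_right:
      "\<lbrakk>U \<in> Sat S; \<V> \<subseteq> Sat S\<rbrakk>
       \<Longrightarrow> sat_conv S (sat_Join S \<V>) U = sat_Join S ((\<lambda>V. sat_conv S V U) ` \<V>)"

locale formal_cover = convergent_cover S
  for S :: "('a, 'x) conv_struct_scheme" (structure) +
  assumes conv_inter:
    "\<lbrakk>U \<subseteq> carrier S; V \<subseteq> carrier S\<rbrakk> \<Longrightarrow> saturation S (U \<odot> V) = saturation S U \<inter> saturation S V"

text \<open>The inverse image of \<open>V\<close> under a relation \<open>r\<close> is the library's \<open>r\<inverse> `` V\<close>.\<close>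

definition basic_cover_map ::
  "('a, 'x) cover_struct_scheme \<Rightarrow> ('b, 'y) cover_struct_scheme \<Rightarrow> ('a \<times> 'b) set \<Rightarrow> bool" where
  "basic_cover_map S T r \<longleftrightarrow>
     r \<subseteq> carrier S \<times> carrier T \<and>
     (\<forall>b \<in> carrier T. \<forall>V. V \<subseteq> carrier T \<longrightarrow> b \<lhd>\<^bsub>T\<^esub> V \<longrightarrow> set_cov S (r\<inverse> `` {b}) (r\<inverse> `` V))"

definition formal_cover_map ::
  "('a, 'x) conv_struct_scheme \<Rightarrow> ('b, 'y) conv_struct_scheme \<Rightarrow> ('a \<times> 'b) set \<Rightarrow> bool" where
  "formal_cover_map S T r \<longleftrightarrow>
     basic_cover_map S T r \<and>
     (\<forall>b\<^sub>1 \<in> carrier T. \<forall>b\<^sub>2 \<in> carrier T.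
        saturation S (r\<inverse> `` ({b\<^sub>1} \<odot>\<^bsub>T\<^esub> {b\<^sub>2})) =
        saturation S ((r\<inverse> `` {b\<^sub>1}) \<odot>\<^bsub>S\<^esub> (r\<inverse> `` {b\<^sub>2}))) \<and>
     saturation S (r\<inverse> `` carrier T) = saturation S (carrier S)"

text \<open>Equality of formal cover maps, as an equivalence relation on their underlying relations.\<close>

definition formal_cover_map_eq ::
  "('a, 'x) conv_struct_scheme \<Rightarrow> ('b, 'y) conv_struct_scheme \<Rightarrow>
   (('a \<times> 'b) set \<times> ('a \<times> 'b) set) set" where
  "formal_cover_map_eq S T =
     {(r\<^sub>1, r\<^sub>2). formal_cover_map S T r\<^sub>1 \<and> formal_cover_map S T r\<^sub>2 \<and>
        (\<forall>b \<in> carrier T. saturation S (r\<^sub>1\<inverse> `` {b}) = saturation S (r\<^sub>2\<inverse> `` {b}))}"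


section \<open>Frames\<close>

text \<open>
  A complete lattice of the library is a partial order with all joins and all meets; with
  impredicative powersets these are exactly the suplattices (cf. \<open>complete_lattice_criterion1\<close>
  and its dual).
\<close>

locale frame = complete_lattice L for L (structure) +
  assumes meet_Join_distrib:
    "\<lbrakk>x \<in> carrier L; A \<subseteq> carrier L\<rbrakk> \<Longrightarrow> x \<sqinter> (\<Squnion>A) = \<Squnion>((\<lambda>a. x \<sqinter> a) ` A)"

text \<open>Extensional functions, so that equality of frame maps is equality on the carrier.\<close>

definition frame_hom :: "('a, 'x) gorder_scheme \<Rightarrow> ('b, 'y) gorder_scheme \<Rightarrow> ('a \<Rightarrow> 'b) set" where
  "frame_hom L M =
     {f \<in> carrier L \<rightarrow>\<^sub>E carrier M. sup_pres L M f \<and> meet_pres L M f \<and> f \<top>\<^bsub>L\<^esub> = \<top>\<^bsub>M\<^esub>}"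


section \<open>The categories of formal covers, frames and locales\<close>

text \<open>
  The objects of the categories are based on the small subsets (``sets'') of a fixed type
  (``classes''). The predicate \<open>powersets_are_small\<close> is the impredicativity assumption: subsets
  of small sets are small, and the powerset of a small set is small. Since the powerset has the
  type \<open>'u set\<close>, the latter is expressed up to bijection.
\<close>

definition powersets_are_small :: "('u set \<Rightarrow> bool) \<Rightarrow> bool" where
  "powersets_are_small small \<longleftrightarrow>
     (\<forall>A B. small A \<longrightarrow> B \<subseteq> A \<longrightarrow> small B) \<and>
     (\<forall>A. small A \<longrightarrow> (\<exists>B. small B \<and> Pow A \<approx> B))"

text \<open>
  Arrows are formal cover maps modulo equality. In terms of relations, \<open>s\<close> after \<open>r\<close> is
  \<open>r O s\<close>.
\<close>

definition FCov :: "('u set \<Rightarrow> bool) \<Rightarrow> ('u conv_struct, ('u \<times> 'u) set set) cat" where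
  "FCov small =
     \<lparr>obj = {S. formal_cover S \<and> small (carrier S)},
      hom_set = (\<lambda>S T. {r. formal_cover_map S T r} // formal_cover_map_eq S T),
      cmp = (\<lambda>S T W \<sigma> \<rho>. \<Union>r \<in> \<rho>. \<Union>s \<in> \<sigma>. formal_cover_map_eq S W `` {r O s}),
      idt = (\<lambda>S. formal_cover_map_eq S S `` {Id_on (carrier S)})\<rparr>"

definition Frm :: "('u set \<Rightarrow> bool) \<Rightarrow> ('u gorder, 'u \<Rightarrow> 'u) cat" where
  "Frm small =
     \<lparr>obj = {L. frame L \<and> small (carrier L)},
      hom_set = frame_hom,
      cmp = (\<lambda>L M N g f. compose (carrier L) g f),
      idt = (\<lambda>L. \<lambda>x \<in> carrier L. x)\<rparr>"

definition Loc :: "('u set \<Rightarrow> bool) \<Rightarrow> ('u gorder, 'u \<Rightarrow> 'u) cat" where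
  "Loc small = opposite (Frm small)"

end

theory Submission
  imports Defs
begin

text \<open>
  A formal cover is a presentation of a frame: points are generators, covers are relations, and
  the frame presented is the lattice of saturated subsets, with intersection as meet. A formal cover
  map \<open>r\<close> acts on subsets of its codomain by \<open>U \<mapsto> saturation S (r\<inverse> `` U)\<close>. Being a formal cover
  map means exactly that this action induces a frame map between saturated subsets in the opposite
  direction (\<open>formal_cover_map_iff\<close>), and equality of formal cover maps is equality of actions
  (\<open>formal_cover_map_eq_iff\<close>).

  Conversely a frame \<open>L\<close> is a formal cover on its own elements, where \<open>a\<close> is covered by \<open>U\<close> if
  \<open>a \<sqsubseteq> \<Squnion>U\<close> and the operation is the pointwise meet (\<open>formal_cover_frame_cover\<close>). A frame map \<open>f\<close>
  from \<open>L\<close> to \<open>M\<close> corresponds to the relation \<open>b \<sqsubseteq> f a\<close> between \<open>M\<close> and \<open>L\<close>. The saturated subsets of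
  this cover are the principal ideals of \<open>L\<close>, so the assignment is a fully faithful functor from the opposite of
  frames to formal covers (\<open>fully_faithful_frame_cover_functor\<close>).

  It is also essentially surjective: a formal cover is isomorphic to the cover of its frame of
  saturated subsets (\<open>isomorphism_frame_cover_Sat\<close>). That frame consists of subsets, hence must be
  replaced by a copy inside the universe, which exists when powersets of small sets are
  small. A fully faithful and essentially surjective functor is part of an equivalence
  (\<open>equivalent_if_essentially_surjective\<close>); both claims of the theorem are this equivalence, since
  the category of locales is by definition the opposite of the category of frames.
\<close>

section \<open>Equivalences from fully faithful functors\<close>

lemma (in category) category_opposite: "category (opposite C)"
  by unfold_locales
    (auto simp: opposite_def idt_closed cmp_closed cmp_idt_left cmp_idt_right cmp_assoc)

text \<open>
  The functor from frames to covers is canonical, whereas a quasi-inverse depends on a chosen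
  encoding of powersets by elements of the universe. Working with full faithfulness allows this
  choice to be made for one object at a time, without checking any compatibility with maps.
\<close>

locale fully_faithful_functor = cat_functor C D F for C D F +
  assumes fully_faithful:
    "\<lbrakk>X \<in> obj C; Y \<in> obj C\<rbrakk>
     \<Longrightarrow> bij_betw (on_hom F X Y) (hom_set C X Y) (hom_set D (on_obj F X) (on_obj F Y))"
begin

lemma faithful:
  "\<lbrakk>X \<in> obj C; Y \<in> obj C; f \<in> hom_set C X Y; g \<in> hom_set C X Y;
    on_hom F X Y f = on_hom F X Y g\<rbrakk> \<Longrightarrow> f = g"
  by (meson bij_betw_imp_inj_on fully_faithful inj_onD)

definition preimage_hom where
  "preimage_hom X Y = inv_into (hom_set C X Y) (on_hom F X Y)"

lemma
  assumes "X \<in> obj C" "Y \<in> obj C" "h \<in> hom_set D (on_obj F X) (on_obj F Y)"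
  shows preimage_hom_closed: "preimage_hom X Y h \<in> hom_set C X Y"
    and on_hom_preimage_hom: "on_hom F X Y (preimage_hom X Y h) = h"
  using fully_faithful[OF assms(1,2)] assms(3) unfolding preimage_hom_def bij_betw_def
  by (metis inv_into_into, metis f_inv_into_f)

text \<open>
  An inverse downstairs is the image of a unique arrow upstairs, and faithfulness turns the two
  inverse laws for the images into inverse laws for the arrows themselves.
\<close>

lemma isomorphism_reflected:
  assumes X: "X \<in> obj C" and Y: "Y \<in> obj C" and f: "f \<in> hom_set C X Y"
    and iso: "isomorphism D (on_obj F X) (on_obj F Y) (on_hom F X Y f)"
  shows "isomorphism C X Y f"
proof -
  from iso obtain h where h: "h \<in> hom_set D (on_obj F Y) (on_obj F X)"
    and hf: "cmp D (on_obj F X) (on_obj F Y) (on_obj F X) h (on_hom F X Y f) = idt D (on_obj F X)"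
    and fh: "cmp D (on_obj F Y) (on_obj F X) (on_obj F Y) (on_hom F X Y f) h = idt D (on_obj F Y)"
    unfolding isomorphism_def by blast
  let ?g = "preimage_hom Y X h"
  have g: "?g \<in> hom_set C Y X" and Fg: "on_hom F Y X ?g = h"
    using X Y h by (auto intro: preimage_hom_closed on_hom_preimage_hom)
  have "cmp C X Y X ?g f = idt C X"
    by (rule faithful[OF X X])
      (use X Y f g in \<open>auto simp: on_hom_cmp on_hom_idt Fg hf source.cmp_closed source.idt_closed\<close>)
  moreover have "cmp C Y X Y f ?g = idt C Y"
    by (rule faithful[OF Y Y])
      (use X Y f g in \<open>auto simp: on_hom_cmp on_hom_idt Fg fh source.cmp_closed source.idt_closed\<close>)
  ultimately show ?thesis
    unfolding isomorphism_def using f g by blast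
qed

text \<open>
  Choose for every object \<open>Z\<close> of \<open>D\<close> an object \<open>G\<^sub>0 Z\<close> of \<open>C\<close> and an isomorphism
  \<open>u Z : Z \<rightarrow> F (G\<^sub>0 Z)\<close> with inverse \<open>v Z\<close>. Conjugation by \<open>u\<close> is functorial; since \<open>F\<close> is fully
  faithful it lifts to a functor \<open>G : D \<rightarrow> C\<close>, and \<open>u\<close> becomes natural by construction. The
  other natural isomorphism is the lift of \<open>v (F X) : F (G\<^sub>0 (F X)) \<rightarrow> F X\<close> along \<open>F\<close>.
\<close>

theorem equivalent_if_essentially_surjective:
  assumes "\<And>Z. Z \<in> obj D \<Longrightarrow> \<exists>X \<in> obj C. \<exists>u. isomorphism D Z (on_obj F X) u"
  shows "equivalent_categories D C"
proof -
  have "\<exists>X u v. X \<in> obj C \<and> u \<in> hom_set D Z (on_obj F X) \<and> v \<in> hom_set D (on_obj F X) Z \<and>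
      cmp D Z (on_obj F X) Z v u = idt D Z \<and>
      cmp D (on_obj F X) Z (on_obj F X) u v = idt D (on_obj F X)" if "Z \<in> obj D" for Z
    using assms[OF that] unfolding isomorphism_def by blast
  then obtain G0 u v where
    G0: "\<And>Z. Z \<in> obj D \<Longrightarrow> G0 Z \<in> obj C" and
    u: "\<And>Z. Z \<in> obj D \<Longrightarrow> u Z \<in> hom_set D Z (on_obj F (G0 Z))" and
    v: "\<And>Z. Z \<in> obj D \<Longrightarrow> v Z \<in> hom_set D (on_obj F (G0 Z)) Z" and
    vu: "\<And>Z. Z \<in> obj D \<Longrightarrow> cmp D Z (on_obj F (G0 Z)) Z (v Z) (u Z) = idt D Z" and
    uv: "\<And>Z. Z \<in> obj D \<Longrightarrow>
      cmp D (on_obj F (G0 Z)) Z (on_obj F (G0 Z)) (u Z) (v Z) = idt D (on_obj F (G0 Z))"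
    by metis
  define T where "T Z = on_obj F (G0 Z)" for Z
  have T: "\<And>Z. Z \<in> obj D \<Longrightarrow> T Z \<in> obj D"
    by (simp add: T_def G0 on_obj_closed)
  note u = u[folded T_def] and v = v[folded T_def] and vu = vu[folded T_def]
    and uv = uv[folded T_def]
  define con where "con Z W h = cmp D (T Z) W (T W) (u W) (cmp D (T Z) Z W h (v Z))" for Z W h
  have con: "con Z W h \<in> hom_set D (T Z) (T W)"
    if "Z \<in> obj D" "W \<in> obj D" "h \<in> hom_set D Z W" for Z W h
    unfolding con_def using that u v T by (meson target.cmp_closed)
  \<comment> \<open>Naturality of \<open>u\<close> and of \<open>v\<close>, before lifting along \<open>F\<close>.\<close>
  have con_u: "cmp D Z (T Z) (T W) (con Z W h) (u Z) = cmp D Z W (T W) (u W) h"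
    if Z: "Z \<in> obj D" and W: "W \<in> obj D" and h: "h \<in> hom_set D Z W" for Z W h
  proof -
    have "cmp D Z (T Z) (T W) (con Z W h) (u Z)
        = cmp D Z W (T W) (u W) (cmp D Z (T Z) W (cmp D (T Z) Z W h (v Z)) (u Z))"
      unfolding con_def
      by (rule target.cmp_assoc[symmetric]) (use Z W h u v T target.cmp_closed in auto)
    also have "cmp D Z (T Z) W (cmp D (T Z) Z W h (v Z)) (u Z)
        = cmp D Z Z W h (cmp D Z (T Z) Z (v Z) (u Z))"
      by (rule target.cmp_assoc[symmetric]) (use Z W h u v T in auto)
    finally show ?thesis using Z W h by (simp add: vu target.cmp_idt_right)
  qed
  have v_con: "cmp D (T Z) (T W) W (v W) (con Z W h) = cmp D (T Z) Z W h (v Z)"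
    if Z: "Z \<in> obj D" and W: "W \<in> obj D" and h: "h \<in> hom_set D Z W" for Z W h
  proof -
    have hv: "cmp D (T Z) Z W h (v Z) \<in> hom_set D (T Z) W"
      using Z W h v T by (auto intro: target.cmp_closed)
    have "cmp D (T Z) (T W) W (v W) (con Z W h)
        = cmp D (T Z) W W (cmp D W (T W) W (v W) (u W)) (cmp D (T Z) Z W h (v Z))"
      unfolding con_def by (rule target.cmp_assoc) (use Z W hv u v T in auto)
    also have "\<dots> = cmp D (T Z) Z W h (v Z)"
      using Z W hv T by (simp add: vu target.cmp_idt_left)
    finally show ?thesis .
  qed
  define G where "G = \<lparr>on_obj = G0, on_hom = (\<lambda>Z W h. preimage_hom (G0 Z) (G0 W) (con Z W h))\<rparr>"
  have G_hom: "on_hom G Z W h \<in> hom_set C (G0 Z) (G0 W)"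
    and FG_hom: "on_hom F (G0 Z) (G0 W) (on_hom G Z W h) = con Z W h"
    if "Z \<in> obj D" "W \<in> obj D" "h \<in> hom_set D Z W" for Z W h
    using con[OF that] that(1,2) unfolding G_def T_def
    by (auto simp: G0 preimage_hom_closed on_hom_preimage_hom)
  have con_idt: "con Z Z (idt D Z) = idt D (T Z)" if Z: "Z \<in> obj D" for Z
    using Z v T by (simp add: con_def target.cmp_idt_left uv)
  have con_cmp: "con X Z (cmp D X Y Z g f) = cmp D (T X) (T Y) (T Z) (con Y Z g) (con X Y f)"
    if X: "X \<in> obj D" and Y: "Y \<in> obj D" and Z: "Z \<in> obj D"
      and f: "f \<in> hom_set D X Y" and g: "g \<in> hom_set D Y Z" for X Y Z f g
  proof -
    have gv: "cmp D (T Y) Y Z g (v Y) \<in> hom_set D (T Y) Z"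
      using X Y Z f g v T by (auto intro: target.cmp_closed)
    have "cmp D (T X) (T Y) (T Z) (con Y Z g) (con X Y f)
        = cmp D (T X) Z (T Z) (u Z) (cmp D (T X) (T Y) Z (cmp D (T Y) Y Z g (v Y)) (con X Y f))"
      unfolding con_def[of Y Z g]
      by (rule target.cmp_assoc[symmetric]) (use X Y Z f u T gv con in auto)
    also have "cmp D (T X) (T Y) Z (cmp D (T Y) Y Z g (v Y)) (con X Y f)
        = cmp D (T X) Y Z g (cmp D (T X) (T Y) Y (v Y) (con X Y f))"
      by (rule target.cmp_assoc[symmetric]) (use X Y Z f g v T con in auto)
    also have "\<dots> = cmp D (T X) Y Z g (cmp D (T X) X Y f (v X))"
      by (simp add: v_con X Y f)
    also have "\<dots> = cmp D (T X) X Z (cmp D X Y Z g f) (v X)"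
      by (rule target.cmp_assoc) (use X Y Z f g v T in auto)
    finally show ?thesis by (simp add: con_def)
  qed
  have G_on_obj: "on_obj G = G0" by (simp add: G_def)
  have G_functor: "cat_functor D C G"
  proof
    show "on_obj G Z \<in> obj C" if "Z \<in> obj D" for Z
      using that by (simp add: G_on_obj G0)
    show "on_hom G Z W h \<in> hom_set C (on_obj G Z) (on_obj G W)"
      if "Z \<in> obj D" "W \<in> obj D" "h \<in> hom_set D Z W" for Z W h
      using G_hom that by (simp add: G_on_obj)
    show "on_hom G Z Z (idt D Z) = idt C (on_obj G Z)" if Z: "Z \<in> obj D" for Z
      unfolding G_on_obj
      by (rule faithful[OF G0[OF Z] G0[OF Z]])
        (use Z G0[OF Z] in \<open>simp_all add: G_hom FG_hom con_idt target.idt_closed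
           source.idt_closed on_hom_idt T_def\<close>)
    show "on_hom G X Z (cmp D X Y Z g f) =
        cmp C (on_obj G X) (on_obj G Y) (on_obj G Z) (on_hom G Y Z g) (on_hom G X Y f)"
      if X: "X \<in> obj D" and Y: "Y \<in> obj D" and Z: "Z \<in> obj D"
        and f: "f \<in> hom_set D X Y" and g: "g \<in> hom_set D Y Z" for X Y Z f g
    proof -
      note gf = target.cmp_closed[OF X Y Z f g]
      show ?thesis
        unfolding G_on_obj
        by (rule faithful[OF G0[OF X] G0[OF Z]])
          (use G0[OF X] G0[OF Y] G0[OF Z] G_hom[OF X Y f] G_hom[OF Y Z g] in
           \<open>simp_all add: G_hom[OF X Z gf] source.cmp_closed on_hom_cmp FG_hom X Y Z f g gf con_cmp
              T_def\<close>)
    qed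
  qed
  have "naturally_isomorphic D D id_ftor (comp_ftor F G)"
    unfolding naturally_isomorphic_def id_ftor_def comp_ftor_def ftor.simps isomorphism_def
    by (rule exI[of _ u])
      (auto simp: G_on_obj FG_hom con_u u uv vu simp flip: T_def intro!: bexI[OF _ v])
  moreover
  define w where "w X = preimage_hom (G0 (on_obj F X)) X (v (on_obj F X))" for X
  have w: "w X \<in> hom_set C (G0 (on_obj F X)) X"
    and Fw: "on_hom F (G0 (on_obj F X)) X (w X) = v (on_obj F X)" if "X \<in> obj C" for X
    using that on_obj_closed[OF that] v[of "on_obj F X"] unfolding w_def T_def
    by (auto simp: G0 preimage_hom_closed on_hom_preimage_hom)
  have "naturally_isomorphic C C (comp_ftor G F) id_ftor"
    unfolding naturally_isomorphic_def id_ftor_def comp_ftor_def G_on_obj ftor.simps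
  proof (intro exI[of _ w] conjI ballI)
    fix X assume X: "X \<in> obj C"
    note FX = on_obj_closed[OF X]
    show "isomorphism C (G0 (on_obj F X)) X (w X)"
      by (rule isomorphism_reflected[OF G0[OF FX] X w[OF X]])
        (use v uv vu FX X in
          \<open>auto simp: isomorphism_def Fw intro!: bexI[OF _ u[OF FX]] simp flip: T_def\<close>)
  next
    fix X Y f assume X: "X \<in> obj C" and Y: "Y \<in> obj C" and f: "f \<in> hom_set C X Y"
    note FX = on_obj_closed[OF X] and FY = on_obj_closed[OF Y] and Ff = on_hom_closed[OF X Y f]
    note GFf = G_hom[OF FX FY Ff]
    show "cmp C (G0 (on_obj F X)) (G0 (on_obj F Y)) Y (w Y)
            (on_hom G (on_obj F X) (on_obj F Y) (on_hom F X Y f)) =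
          cmp C (G0 (on_obj F X)) X Y f (w X)"
      by (rule faithful[OF G0[OF FX] Y])
        (use X Y f w[OF X] w[OF Y] GFf G0[OF FX] G0[OF FY] FX FY Ff in
         \<open>simp_all add: source.cmp_closed on_hom_cmp Fw FG_hom v_con flip: T_def\<close>)
  qed
  ultimately show ?thesis
    unfolding equivalent_categories_def using G_functor cat_functor_axioms by blast
qed

end

section \<open>Saturation and the category of formal covers\<close>
lemma (in basic_cover) saturation_subset: "saturation S U \<subseteq> carrier S"
  by (auto simp: saturation_def)

lemma (in basic_cover) saturation_extensive: "U \<subseteq> carrier S \<Longrightarrow> U \<subseteq> saturation S U"
  by (auto simp: saturation_def cov_refl)

lemma (in basic_cover) set_cov_iff: "set_cov S U V \<longleftrightarrow> U \<subseteq> saturation S V"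
  using cov_between by (auto simp: set_cov_def saturation_def)

lemma (in basic_cover) saturation_least:
  assumes "V \<subseteq> carrier S" "U \<subseteq> saturation S V"
  shows "saturation S U \<subseteq> saturation S V"
proof
  fix a assume "a \<in> saturation S U"
  moreover have "U \<subseteq> carrier S"
    using assms(2) saturation_subset by blast
  ultimately show "a \<in> saturation S V"
    using assms cov_trans[of U V a] by (auto simp: saturation_def set_cov_def)
qed

lemma (in basic_cover) saturation_mono:
  "\<lbrakk>U \<subseteq> V; V \<subseteq> carrier S\<rbrakk> \<Longrightarrow> saturation S U \<subseteq> saturation S V"
  by (rule saturation_least) (use saturation_extensive[of V] in auto)

lemma (in basic_cover) saturation_idem:
  "U \<subseteq> carrier S \<Longrightarrow> saturation S (saturation S U) = saturation S U"
  by (intro equalityI saturation_least saturation_extensive) (auto simp: saturation_def)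

lemma (in basic_cover) saturation_carrier: "saturation S (carrier S) = carrier S"
  using saturation_subset saturation_extensive by blast

lemma (in basic_cover) saturation_in_Sat: "U \<subseteq> carrier S \<Longrightarrow> saturation S U \<in> Sat S"
  by (auto simp: Sat_def saturation_idem saturation_subset[THEN subsetD])

lemma Sat_subset: "U \<in> Sat S \<Longrightarrow> U \<subseteq> carrier S"
  by (simp add: Sat_def)

lemma (in basic_cover) saturation_UN:
  assumes "\<And>i. i \<in> I \<Longrightarrow> U i \<subseteq> carrier S"
  shows "saturation S (\<Union>i\<in>I. saturation S (U i)) = saturation S (\<Union>i\<in>I. U i)"
proof (rule equalityI)
  show "saturation S (\<Union>i\<in>I. saturation S (U i)) \<subseteq> saturation S (\<Union>i\<in>I. U i)"
    using assms by (intro saturation_least UN_least saturation_mono) auto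
  show "saturation S (\<Union>i\<in>I. U i) \<subseteq> saturation S (\<Union>i\<in>I. saturation S (U i))"
    using assms saturation_subset
    by (intro saturation_mono UN_mono saturation_extensive UN_least) auto
qed

lemma (in formal_cover) saturation_conv:
  "\<lbrakk>U \<in> Sat S; V \<in> Sat S\<rbrakk> \<Longrightarrow> sat_conv S U V = U \<inter> V"
  using conv_inter by (auto simp: sat_conv_def Sat_def)

lemma (in formal_cover) Int_sat_Join:
  assumes "U \<in> Sat S" "\<V> \<subseteq> Sat S"
  shows "U \<inter> sat_Join S \<V> = sat_Join S ((\<lambda>V. U \<inter> V) ` \<V>)"
proof -
  have "\<Union>\<V> \<subseteq> carrier S" using assms by (auto simp: Sat_def)
  then have "sat_Join S \<V> \<in> Sat S" by (simp add: sat_Join_def saturation_in_Sat)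
  moreover have "(\<lambda>V. sat_conv S U V) ` \<V> = (\<lambda>V. U \<inter> V) ` \<V>"
    using assms by (intro image_cong refl saturation_conv) auto
  ultimately show ?thesis
    using sat_conv_distrib_left[OF assms] by (simp add: saturation_conv assms)
qed

text \<open>
  The frame law of the saturated subsets, in the two-sided form that matches a pair of unions of
  points: in a formal cover the induced operation on saturated subsets is intersection, so the
  distributivity axiom applied in each variable gives the claim.
\<close>

lemma (in formal_cover) saturation_UN_Int_UN:
  assumes U: "\<And>i. i \<in> I \<Longrightarrow> U i \<in> Sat S" and V: "\<And>j. j \<in> J \<Longrightarrow> V j \<in> Sat S"
  shows "saturation S (\<Union>i\<in>I. U i) \<inter> saturation S (\<Union>j\<in>J. V j)
       = saturation S (\<Union>i\<in>I. \<Union>j\<in>J. U i \<inter> V j)"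
proof -
  have Vc: "(\<Union>j\<in>J. V j) \<subseteq> carrier S" by (intro UN_least Sat_subset V)
  have "saturation S (\<Union>i\<in>I. U i) \<inter> saturation S (\<Union>j\<in>J. V j)
      = saturation S (\<Union>j\<in>J. V j) \<inter> sat_Join S (U ` I)"
    by (auto simp: sat_Join_def)
  also have "\<dots> = saturation S (\<Union>i\<in>I. U i \<inter> saturation S (\<Union>j\<in>J. V j))"
    using U Vc by (subst Int_sat_Join) (auto simp: saturation_in_Sat sat_Join_def Int_commute)
  also have "(\<Union>i\<in>I. U i \<inter> saturation S (\<Union>j\<in>J. V j))
           = (\<Union>i\<in>I. saturation S (\<Union>j\<in>J. U i \<inter> V j))"
  proof (rule SUP_cong)
    fix i assume "i \<in> I"
    then show "U i \<inter> saturation S (\<Union>j\<in>J. V j) = saturation S (\<Union>j\<in>J. U i \<inter> V j)"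
      using Int_sat_Join[of "U i" "V ` J"] U V by (auto simp: sat_Join_def image_image)
  qed simp
  also have "saturation S (\<Union>i\<in>I. saturation S (\<Union>j\<in>J. U i \<inter> V j))
           = saturation S (\<Union>i\<in>I. \<Union>j\<in>J. U i \<inter> V j)"
    using Sat_subset[OF U] by (intro saturation_UN) blast
  finally show ?thesis .
qed

text \<open>
  A cover map \<open>r\<close> acts on subsets of its codomain by saturated inverse images. Two cover maps are
  equal precisely when these actions agree, and everything that is proved about cover maps below is
  proved through their actions.
\<close>

definition sat_preimage ::
  "('a, 'x) cover_struct_scheme \<Rightarrow> ('a \<times> 'b) set \<Rightarrow> 'b set \<Rightarrow> 'a set" where
  "sat_preimage S r V = saturation S (r\<inverse> `` V)"

lemma (in basic_cover) sat_preimage_UN: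
  assumes "r \<subseteq> carrier S \<times> B"
  shows "sat_preimage S r V = saturation S (\<Union>b\<in>V. sat_preimage S r {b})"
proof -
  have "saturation S (\<Union>b\<in>V. sat_preimage S r {b}) = saturation S (\<Union>b\<in>V. r\<inverse> `` {b})"
    unfolding sat_preimage_def using assms by (intro saturation_UN) auto
  also have "(\<Union>b\<in>V. r\<inverse> `` {b}) = r\<inverse> `` V" by auto
  finally show ?thesis by (simp add: sat_preimage_def)
qed

lemma (in basic_cover) sat_preimage_mono:
  assumes "r \<subseteq> carrier S \<times> B" "U \<subseteq> V"
  shows "sat_preimage S r U \<subseteq> sat_preimage S r V"
  unfolding sat_preimage_def using assms by (intro saturation_mono) auto

text \<open>
  A relation is a basic cover map precisely when its action depends on the saturation of a subset
  only, so that it descends to the saturated subsets.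
\<close>

lemma basic_cover_map_iff:
  assumes "basic_cover S" "basic_cover T" and r: "r \<subseteq> carrier S \<times> carrier T"
  shows "basic_cover_map S T r \<longleftrightarrow>
    (\<forall>V. V \<subseteq> carrier T \<longrightarrow> sat_preimage S r (saturation T V) = sat_preimage S r V)"
proof -
  interpret S: basic_cover S by fact
  interpret T: basic_cover T by fact
  have dom: "r\<inverse> `` V \<subseteq> carrier S" for V using r by auto
  show ?thesis
  proof
    assume "basic_cover_map S T r"
    then have "r\<inverse> `` saturation T V \<subseteq> saturation S (r\<inverse> `` V)" if "V \<subseteq> carrier T" for V
      using that unfolding basic_cover_map_def S.set_cov_iff saturation_def by blast
    then show "\<forall>V. V \<subseteq> carrier T \<longrightarrow> sat_preimage S r (saturation T V) = sat_preimage S r V"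
      using S.saturation_least[OF dom] T.saturation_extensive S.sat_preimage_mono[OF r]
      unfolding sat_preimage_def by (meson subset_antisym)
  next
    assume *: "\<forall>V. V \<subseteq> carrier T \<longrightarrow> sat_preimage S r (saturation T V) = sat_preimage S r V"
    show "basic_cover_map S T r"
      unfolding basic_cover_map_def
    proof (intro conjI ballI allI impI r)
      fix b V assume "V \<subseteq> carrier T" "b \<lhd>\<^bsub>T\<^esub> V"
      then have "{b} \<subseteq> saturation T V" using T.cov_between by (auto simp: saturation_def)
      then have "sat_preimage S r {b} \<subseteq> sat_preimage S r V"
        using * \<open>V \<subseteq> carrier T\<close> S.sat_preimage_mono[OF r] by metis
      then show "set_cov S (r\<inverse> `` {b}) (r\<inverse> `` V)"
        using S.saturation_extensive[OF dom, of "{b}"] S.set_cov_iff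
        by (auto simp: sat_preimage_def)
    qed
  qed
qed

text \<open>
  Formal cover maps are the relations whose action on saturated subsets is a frame map. The
  definition asks for compatibility with \<open>\<odot>\<close> at pairs of points only; since a saturated subset is
  the join of the saturations of its points and intersections distribute over joins, this
  yields compatibility with all binary intersections. In this form the condition is visibly
  closed under composition.
\<close>

lemma formal_cover_map_iff:
  assumes "formal_cover S" "formal_cover T"
  shows "formal_cover_map S T r \<longleftrightarrow>
    r \<subseteq> carrier S \<times> carrier T \<and>
    (\<forall>V. V \<subseteq> carrier T \<longrightarrow> sat_preimage S r (saturation T V) = sat_preimage S r V) \<and>
    (\<forall>U V. U \<subseteq> carrier T \<longrightarrow> V \<subseteq> carrier T \<longrightarrow>
       sat_preimage S r (saturation T U \<inter> saturation T V)
       = sat_preimage S r U \<inter> sat_preimage S r V) \<and>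
    sat_preimage S r (carrier T) = carrier S" (is "?lhs \<longleftrightarrow> ?sub \<and> ?join \<and> ?meet \<and> ?top")
proof -
  interpret S: formal_cover S by fact
  interpret T: formal_cover T by fact
  have conv_singleton:
    "saturation S (r\<inverse> `` ({b\<^sub>1} \<odot>\<^bsub>T\<^esub> {b\<^sub>2})) =
       sat_preimage S r (saturation T {b\<^sub>1} \<inter> saturation T {b\<^sub>2}) \<and>
     saturation S ((r\<inverse> `` {b\<^sub>1}) \<odot>\<^bsub>S\<^esub> (r\<inverse> `` {b\<^sub>2})) =
       sat_preimage S r {b\<^sub>1} \<inter> sat_preimage S r {b\<^sub>2}"
    if ?sub ?join "b\<^sub>1 \<in> carrier T" "b\<^sub>2 \<in> carrier T" for b\<^sub>1 b\<^sub>2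
  proof
    have "saturation S (r\<inverse> `` ({b\<^sub>1} \<odot>\<^bsub>T\<^esub> {b\<^sub>2})) = sat_preimage S r (saturation T ({b\<^sub>1} \<odot>\<^bsub>T\<^esub> {b\<^sub>2}))"
      using that T.conv_closed[of "{b\<^sub>1}" "{b\<^sub>2}"] by (simp add: sat_preimage_def)
    then show "saturation S (r\<inverse> `` ({b\<^sub>1} \<odot>\<^bsub>T\<^esub> {b\<^sub>2})) =
        sat_preimage S r (saturation T {b\<^sub>1} \<inter> saturation T {b\<^sub>2})"
      using that by (simp add: T.conv_inter)
    show "saturation S ((r\<inverse> `` {b\<^sub>1}) \<odot>\<^bsub>S\<^esub> (r\<inverse> `` {b\<^sub>2})) =
        sat_preimage S r {b\<^sub>1} \<inter> sat_preimage S r {b\<^sub>2}"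
      unfolding sat_preimage_def using that(1) by (intro S.conv_inter) auto
  qed
  have meet_iff: "?meet \<longleftrightarrow> (\<forall>b\<^sub>1 \<in> carrier T. \<forall>b\<^sub>2 \<in> carrier T.
      sat_preimage S r (saturation T {b\<^sub>1} \<inter> saturation T {b\<^sub>2})
      = sat_preimage S r {b\<^sub>1} \<inter> sat_preimage S r {b\<^sub>2})" (is "_ \<longleftrightarrow> ?points")
    if sub: ?sub and join: ?join
  proof
    assume ?meet
    then show ?points by simp
  next
    assume points: ?points
    have dom: "r\<inverse> `` V \<subseteq> carrier S" for V using sub by auto
    \<comment> \<open>The inclusion from left to right is monotonicity; the other one reduces to pairs of points.\<close>
    show ?meet
    proof (intro allI impI equalityI)
      fix U V assume U: "U \<subseteq> carrier T" and V: "V \<subseteq> carrier T"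
      have "sat_preimage S r (saturation T U \<inter> saturation T V) \<subseteq> sat_preimage S r (saturation T U)"
        and "sat_preimage S r (saturation T U \<inter> saturation T V) \<subseteq> sat_preimage S r (saturation T V)"
        by (intro S.sat_preimage_mono[OF sub]; blast)+
      then show "sat_preimage S r (saturation T U \<inter> saturation T V)
          \<subseteq> sat_preimage S r U \<inter> sat_preimage S r V"
        using join U V by auto
      have "sat_preimage S r U \<inter> sat_preimage S r V
          = saturation S (\<Union>b\<in>U. \<Union>c\<in>V. sat_preimage S r {b} \<inter> sat_preimage S r {c})"
        unfolding S.sat_preimage_UN[OF sub, of U] S.sat_preimage_UN[OF sub, of V]
        by (rule S.saturation_UN_Int_UN) (unfold sat_preimage_def, (rule S.saturation_in_Sat dom)+)
      also have "(\<Union>b\<in>U. \<Union>c\<in>V. sat_preimage S r {b} \<inter> sat_preimage S r {c})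
          = (\<Union>b\<in>U. \<Union>c\<in>V. sat_preimage S r (saturation T {b} \<inter> saturation T {c}))"
        using points U V by (intro SUP_cong refl) auto
      also have "saturation S \<dots> \<subseteq> sat_preimage S r (saturation T U \<inter> saturation T V)"
      proof -
        have "sat_preimage S r (saturation T {b} \<inter> saturation T {c})
            \<subseteq> sat_preimage S r (saturation T U \<inter> saturation T V)" if "b \<in> U" "c \<in> V" for b c
          using that U V
          by (intro S.sat_preimage_mono[OF sub] Int_mono T.saturation_mono) auto
        then show ?thesis
          unfolding sat_preimage_def by - (rule S.saturation_least[OF dom], intro UN_least)
      qed
      finally show "sat_preimage S r U \<inter> sat_preimage S r V
          \<subseteq> sat_preimage S r (saturation T U \<inter> saturation T V)" .
    qed
  qed
  have lhs_iff: "?lhs \<longleftrightarrow> ?sub \<and> ?join \<and> (\<forall>b\<^sub>1 \<in> carrier T. \<forall>b\<^sub>2 \<in> carrier T.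
        saturation S (r\<inverse> `` ({b\<^sub>1} \<odot>\<^bsub>T\<^esub> {b\<^sub>2})) =
        saturation S ((r\<inverse> `` {b\<^sub>1}) \<odot>\<^bsub>S\<^esub> (r\<inverse> `` {b\<^sub>2}))) \<and> ?top"
    using basic_cover_map_iff[OF S.basic_cover_axioms T.basic_cover_axioms, of r]
    unfolding formal_cover_map_def S.saturation_carrier sat_preimage_def[of S r "carrier T"]
    by (auto simp only: basic_cover_map_def)
  show ?thesis
  proof (cases "?sub \<and> ?join")
    case True
    then have sub: ?sub and join: ?join by blast+
    have "(\<forall>b\<^sub>1 \<in> carrier T. \<forall>b\<^sub>2 \<in> carrier T.
        saturation S (r\<inverse> `` ({b\<^sub>1} \<odot>\<^bsub>T\<^esub> {b\<^sub>2})) =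
        saturation S ((r\<inverse> `` {b\<^sub>1}) \<odot>\<^bsub>S\<^esub> (r\<inverse> `` {b\<^sub>2}))) \<longleftrightarrow> ?meet"
      unfolding meet_iff[OF sub join] by (intro ball_cong refl) (simp add: conv_singleton[OF sub join])
    then show ?thesis unfolding lhs_iff by argo
  next
    case False
    then show ?thesis unfolding lhs_iff by argo
  qed
qed

text \<open>
  The action is contravariantly functorial. The inner saturation does no harm because the outer
  action ignores it.
\<close>

lemma sat_preimage_relcomp:
  assumes "formal_cover S" "formal_cover T" "formal_cover_map S T r" "s \<subseteq> carrier T \<times> B"
  shows "sat_preimage S (r O s) U = sat_preimage S r (sat_preimage T s U)"
proof -
  have "(r O s)\<inverse> `` U = r\<inverse> `` (s\<inverse> `` U)" by auto
  moreover have "s\<inverse> `` U \<subseteq> carrier T" using assms by auto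
  ultimately show ?thesis
    using formal_cover_map_iff[OF assms(1,2)] assms(3) by (auto simp: sat_preimage_def)
qed

lemma sat_preimage_Id_on: "U \<subseteq> carrier S \<Longrightarrow> sat_preimage S (Id_on (carrier S)) U = saturation S U"
  unfolding sat_preimage_def by (rule arg_cong[where f = "saturation S"]) auto

lemma formal_cover_map_Id_on:
  assumes "formal_cover S"
  shows "formal_cover_map S S (Id_on (carrier S))"
proof -
  interpret S: formal_cover S by fact
  have "sat_preimage S (Id_on (carrier S)) (saturation S U \<inter> saturation S V)
      = saturation S U \<inter> saturation S V"
    if "U \<subseteq> carrier S" "V \<subseteq> carrier S" for U V
    using S.saturation_subset S.saturation_idem S.conv_inter[OF that] S.conv_closed[OF that]
    by (metis sat_preimage_Id_on)
  then show ?thesis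
    unfolding formal_cover_map_iff[OF assms assms]
    by (auto simp: sat_preimage_Id_on S.saturation_subset S.saturation_idem S.saturation_carrier)
qed

lemma formal_cover_map_relcomp:
  assumes S: "formal_cover S" and T: "formal_cover T" and W: "formal_cover W"
    and r: "formal_cover_map S T r" and s: "formal_cover_map T W s"
  shows "formal_cover_map S W (r O s)"
proof -
  interpret T: formal_cover T by fact
  note r' = r[unfolded formal_cover_map_iff[OF S T]] and s' = s[unfolded formal_cover_map_iff[OF T W]]
  have sub: "s \<subseteq> carrier T \<times> carrier W" using s' by simp
  have sat: "saturation T (sat_preimage T s U) = sat_preimage T s U" for U
    unfolding sat_preimage_def using sub by (intro T.saturation_idem) auto
  have in_T: "sat_preimage T s U \<subseteq> carrier T" for U
    unfolding sat_preimage_def by (rule T.saturation_subset)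
  have "sat_preimage S r (sat_preimage T s U \<inter> sat_preimage T s V)
      = sat_preimage S r (sat_preimage T s U) \<inter> sat_preimage S r (sat_preimage T s V)" for U V
    using r' in_T sat by metis
  then show ?thesis
    unfolding formal_cover_map_iff[OF S W] sat_preimage_relcomp[OF S T r sub]
    using r' s' by auto
qed

lemma formal_cover_map_eq_iff:
  assumes "formal_cover S" "formal_cover T"
  shows "(r\<^sub>1, r\<^sub>2) \<in> formal_cover_map_eq S T \<longleftrightarrow>
    formal_cover_map S T r\<^sub>1 \<and> formal_cover_map S T r\<^sub>2 \<and>
    (\<forall>U. U \<subseteq> carrier T \<longrightarrow> sat_preimage S r\<^sub>1 U = sat_preimage S r\<^sub>2 U)" (is "?lhs \<longleftrightarrow> ?rhs")
proof
  interpret S: formal_cover S by fact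
  assume eq: ?lhs
  then have maps: "formal_cover_map S T r\<^sub>1" "formal_cover_map S T r\<^sub>2"
    by (auto simp: formal_cover_map_eq_def)
  moreover have "sat_preimage S r\<^sub>1 U = sat_preimage S r\<^sub>2 U" if "U \<subseteq> carrier T" for U
  proof -
    have "r\<^sub>1 \<subseteq> carrier S \<times> carrier T" "r\<^sub>2 \<subseteq> carrier S \<times> carrier T"
      using maps by (auto simp only: formal_cover_map_iff[OF assms])
    moreover have "(\<Union>b\<in>U. sat_preimage S r\<^sub>1 {b}) = (\<Union>b\<in>U. sat_preimage S r\<^sub>2 {b})"
      using eq that by (auto simp: formal_cover_map_eq_def sat_preimage_def)
    ultimately show ?thesis
      using S.sat_preimage_UN[of r\<^sub>1] S.sat_preimage_UN[of r\<^sub>2] by metis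
  qed
  ultimately show ?rhs by blast
next
  assume ?rhs
  then show ?lhs by (auto simp: formal_cover_map_eq_def sat_preimage_def)
qed

lemma equiv_formal_cover_map_eq: "equiv {r. formal_cover_map S T r} (formal_cover_map_eq S T)"
  by (rule equivI) (auto simp: formal_cover_map_eq_def refl_on_def sym_def intro!: transI)

abbreviation cover_map_class ::
  "('a, 'x) conv_struct_scheme \<Rightarrow> ('b, 'y) conv_struct_scheme \<Rightarrow> ('a \<times> 'b) set \<Rightarrow> ('a \<times> 'b) set set"
where
  "cover_map_class S T r \<equiv> formal_cover_map_eq S T `` {r}"

lemma cover_map_class_eq_iff:
  assumes "formal_cover S" "formal_cover T" "formal_cover_map S T r\<^sub>1" "formal_cover_map S T r\<^sub>2"
  shows "cover_map_class S T r\<^sub>1 = cover_map_class S T r\<^sub>2 \<longleftrightarrow>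
    (\<forall>U. U \<subseteq> carrier T \<longrightarrow> sat_preimage S r\<^sub>1 U = sat_preimage S r\<^sub>2 U)"
proof -
  have "cover_map_class S T r\<^sub>1 = cover_map_class S T r\<^sub>2 \<longleftrightarrow> (r\<^sub>1, r\<^sub>2) \<in> formal_cover_map_eq S T"
    using assms(3,4) by (intro eq_equiv_class_iff[OF equiv_formal_cover_map_eq]) simp_all
  then show ?thesis
    using assms(3,4) by (simp only: formal_cover_map_eq_iff[OF assms(1,2)] simp_thms)
qed

lemma obj_FCov: "S \<in> obj (FCov small) \<longleftrightarrow> formal_cover S \<and> small (carrier S)"
  by (simp add: FCov_def)

lemma hom_set_FCov_iff:
  "\<rho> \<in> hom_set (FCov small) S T \<longleftrightarrow> (\<exists>r. formal_cover_map S T r \<and> \<rho> = cover_map_class S T r)"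
  by (auto simp: FCov_def quotient_def)

lemma idt_FCov: "idt (FCov small) S = cover_map_class S S (Id_on (carrier S))"
  by (simp add: FCov_def)

text \<open>
  Composition is well defined on classes because the action of a composite is the composite of
  the actions, so it depends on the classes of the two factors only.
\<close>

lemma cmp_FCov:
  assumes S: "formal_cover S" and T: "formal_cover T" and W: "formal_cover W"
    and r: "formal_cover_map S T r" and s: "formal_cover_map T W s"
  shows "cmp (FCov small) S T W (cover_map_class T W s) (cover_map_class S T r)
       = cover_map_class S W (r O s)"
proof -
  have "congruent2 (formal_cover_map_eq S T) (formal_cover_map_eq T W)
          (\<lambda>r s. cover_map_class S W (r O s))"
  proof (rule congruent2I')
    fix r\<^sub>1 r\<^sub>2 s\<^sub>1 s\<^sub>2
    assume "(r\<^sub>1, r\<^sub>2) \<in> formal_cover_map_eq S T" "(s\<^sub>1, s\<^sub>2) \<in> formal_cover_map_eq T W"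
    then have r: "formal_cover_map S T r\<^sub>1" "formal_cover_map S T r\<^sub>2"
        "\<And>U. U \<subseteq> carrier T \<Longrightarrow> sat_preimage S r\<^sub>1 U = sat_preimage S r\<^sub>2 U"
      and s: "formal_cover_map T W s\<^sub>1" "formal_cover_map T W s\<^sub>2"
        "\<And>U. U \<subseteq> carrier W \<Longrightarrow> sat_preimage T s\<^sub>1 U = sat_preimage T s\<^sub>2 U"
      using formal_cover_map_eq_iff[OF S T] formal_cover_map_eq_iff[OF T W] by auto
    have sub: "s\<^sub>1 \<subseteq> carrier T \<times> carrier W" "s\<^sub>2 \<subseteq> carrier T \<times> carrier W"
      using s(1,2) by (auto simp only: formal_cover_map_iff[OF T W])
    have "sat_preimage T s\<^sub>2 U \<subseteq> carrier T" for U
      by (auto simp: sat_preimage_def saturation_def)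
    then show "cover_map_class S W (r\<^sub>1 O s\<^sub>1) = cover_map_class S W (r\<^sub>2 O s\<^sub>2)"
      unfolding cover_map_class_eq_iff[OF S W formal_cover_map_relcomp[OF S T W r(1) s(1)]
          formal_cover_map_relcomp[OF S T W r(2) s(2)]]
        sat_preimage_relcomp[OF S T r(1) sub(1)] sat_preimage_relcomp[OF S T r(2) sub(2)]
      using r(3) s(3) by simp
  qed
  then show ?thesis
    using UN_equiv_class2[OF equiv_formal_cover_map_eq equiv_formal_cover_map_eq] r s
    by (simp add: FCov_def)
qed

lemma category_FCov: "category (FCov small)"
proof
  fix S assume "S \<in> obj (FCov small)"
  then show "idt (FCov small) S \<in> hom_set (FCov small) S S"
    using formal_cover_map_Id_on by (auto simp: obj_FCov hom_set_FCov_iff idt_FCov)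
next
  fix S T W \<rho> \<sigma>
  assume obj: "S \<in> obj (FCov small)" "T \<in> obj (FCov small)" "W \<in> obj (FCov small)"
    and \<rho>: "\<rho> \<in> hom_set (FCov small) S T" and \<sigma>: "\<sigma> \<in> hom_set (FCov small) T W"
  have S: "formal_cover S" and T: "formal_cover T" and W: "formal_cover W"
    using obj by (auto simp: obj_FCov)
  from \<rho> \<sigma> obtain r s where r: "formal_cover_map S T r" "\<rho> = cover_map_class S T r"
    and s: "formal_cover_map T W s" "\<sigma> = cover_map_class T W s"
    by (auto simp: hom_set_FCov_iff)
  then show "cmp (FCov small) S T W \<sigma> \<rho> \<in> hom_set (FCov small) S W"
    using cmp_FCov[OF S T W r(1) s(1)] formal_cover_map_relcomp[OF S T W r(1) s(1)]
    by (auto simp: hom_set_FCov_iff)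
next
  fix S T \<rho>
  assume obj: "S \<in> obj (FCov small)" "T \<in> obj (FCov small)"
    and \<rho>: "\<rho> \<in> hom_set (FCov small) S T"
  have S: "formal_cover S" and T: "formal_cover T"
    using obj by (auto simp: obj_FCov)
  from \<rho> obtain r where r: "formal_cover_map S T r" and \<rho>r: "\<rho> = cover_map_class S T r"
    by (auto simp: hom_set_FCov_iff)
  then have "r \<subseteq> carrier S \<times> carrier T" by (auto simp only: formal_cover_map_iff[OF S T])
  then have "Id_on (carrier S) O r = r" "r O Id_on (carrier T) = r" by auto
  then show "cmp (FCov small) S S T \<rho> (idt (FCov small) S) = \<rho>"
    and "cmp (FCov small) S T T (idt (FCov small) T) \<rho> = \<rho>"
    using cmp_FCov[OF S S T formal_cover_map_Id_on[OF S] r]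
      cmp_FCov[OF S T T r formal_cover_map_Id_on[OF T]]
    by (auto simp: idt_FCov \<rho>r)
next
  fix S T W X \<rho> \<sigma> \<tau>
  assume obj: "S \<in> obj (FCov small)" "T \<in> obj (FCov small)" "W \<in> obj (FCov small)" "X \<in> obj (FCov small)"
    and hom: "\<rho> \<in> hom_set (FCov small) S T" "\<sigma> \<in> hom_set (FCov small) T W"
      "\<tau> \<in> hom_set (FCov small) W X"
  have S: "formal_cover S" and T: "formal_cover T" and W: "formal_cover W" and X: "formal_cover X"
    using obj by (auto simp: obj_FCov)
  from hom obtain r s t where r: "formal_cover_map S T r" "\<rho> = cover_map_class S T r"
    and s: "formal_cover_map T W s" "\<sigma> = cover_map_class T W s"
    and t: "formal_cover_map W X t" "\<tau> = cover_map_class W X t"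
    by (auto simp: hom_set_FCov_iff)
  show "cmp (FCov small) S W X \<tau> (cmp (FCov small) S T W \<sigma> \<rho>)
      = cmp (FCov small) S T X (cmp (FCov small) T W X \<tau> \<sigma>) \<rho>"
    using r s t
    by (simp add: cmp_FCov S T W X formal_cover_map_relcomp[OF S T W] formal_cover_map_relcomp[OF T W X]
        O_assoc)
qed

section \<open>The formal cover of a frame\<close>
context frame
begin

lemma Join_le_iff: "\<lbrakk>A \<subseteq> carrier L; x \<in> carrier L\<rbrakk> \<Longrightarrow> \<Squnion>A \<sqsubseteq> x \<longleftrightarrow> (\<forall>a\<in>A. a \<sqsubseteq> x)"
  by (meson le_trans subsetD sup_closed sup_least sup_upper)

lemma le_meet_iff:
  "\<lbrakk>x \<in> carrier L; y \<in> carrier L; z \<in> carrier L\<rbrakk> \<Longrightarrow> x \<sqsubseteq> y \<sqinter> z \<longleftrightarrow> x \<sqsubseteq> y \<and> x \<sqsubseteq> z"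
  by (meson le_trans meet_closed meet_le meet_left meet_right)

definition down :: "'a \<Rightarrow> 'a set" where
  "down x = {a \<in> carrier L. a \<sqsubseteq> x}"

lemma down_inject: "\<lbrakk>x \<in> carrier L; y \<in> carrier L\<rbrakk> \<Longrightarrow> down x = down y \<longleftrightarrow> x = y"
  unfolding down_def using le_antisym le_refl by blast

lemma down_meet: "\<lbrakk>x \<in> carrier L; y \<in> carrier L\<rbrakk> \<Longrightarrow> down (x \<sqinter> y) = down x \<inter> down y"
  by (auto simp: down_def le_meet_iff)

lemma Join_eq_iff:
  assumes "A \<subseteq> carrier L" "x \<in> carrier L"
  shows "\<Squnion>A = x \<longleftrightarrow> (\<forall>y \<in> carrier L. x \<sqsubseteq> y \<longleftrightarrow> (\<forall>a\<in>A. a \<sqsubseteq> y))"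
  using assms Join_le_iff[OF assms(1)] sup_closed[OF assms(1)] le_antisym le_refl by metis

lemma Join_down: "x \<in> carrier L \<Longrightarrow> \<Squnion>(down x) = x"
  unfolding down_def by (intro le_antisym sup_least sup_upper sup_closed) auto

lemma Join_carrier: "\<Squnion>(carrier L) = \<top>"
  using weak_sup_carrier by (simp add: eq_is_equal)

lemma Join_UN:
  assumes "\<And>i. i \<in> I \<Longrightarrow> A i \<subseteq> carrier L"
  shows "\<Squnion>(\<Union>i\<in>I. A i) = \<Squnion>((\<lambda>i. \<Squnion>(A i)) ` I)"
  using assms by (subst Join_eq_iff) (auto simp: Join_le_iff image_subset_iff UN_least)

lemma Join_pointwise_meet:
  assumes U: "U \<subseteq> carrier L" and V: "V \<subseteq> carrier L"
  shows "\<Squnion>{u \<sqinter> v |u v. u \<in> U \<and> v \<in> V} = \<Squnion>U \<sqinter> \<Squnion>V"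
proof -
  have Vc: "\<Squnion>V \<in> carrier L" using V by simp
  have "\<Squnion>{u \<sqinter> v |u v. u \<in> U \<and> v \<in> V} = \<Squnion>(\<Union>u\<in>U. (\<lambda>v. u \<sqinter> v) ` V)"
    by (rule arg_cong[where f = "\<lambda>A. \<Squnion>A"]) auto
  also have "\<dots> = \<Squnion>((\<lambda>u. \<Squnion>((\<lambda>v. u \<sqinter> v) ` V)) ` U)"
    using U V by (intro Join_UN) (auto intro!: meet_closed)
  also have "(\<lambda>u. \<Squnion>((\<lambda>v. u \<sqinter> v) ` V)) ` U = (\<lambda>u. \<Squnion>V \<sqinter> u) ` U"
  proof (rule image_cong)
    fix u assume "u \<in> U"
    then show "\<Squnion>((\<lambda>v. u \<sqinter> v) ` V) = \<Squnion>V \<sqinter> u"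
      using U V meet_Join_distrib[of u V] meet_comm[of L u "\<Squnion>V"] by (simp add: subset_iff)
  qed simp
  also have "\<Squnion>\<dots> = \<Squnion>U \<sqinter> \<Squnion>V"
    using U Vc meet_Join_distrib[OF Vc U] meet_comm[of L "\<Squnion>V" "\<Squnion>U"] by simp
  finally show ?thesis .
qed

end

text \<open>
  Every frame \<open>L\<close> presents itself: the points of the cover are all elements of \<open>L\<close>, and the
  saturated subsets are the principal ideals.
\<close>

definition frame_cover :: "('a, 'x) gorder_scheme \<Rightarrow> 'a conv_struct" where
  "frame_cover L =
     \<lparr>carrier = carrier L,
      cov = (\<lambda>a U. a \<in> carrier L \<and> U \<subseteq> carrier L \<and> a \<sqsubseteq>\<^bsub>L\<^esub> \<Squnion>\<^bsub>L\<^esub>U),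
      conv = (\<lambda>U V. {u \<sqinter>\<^bsub>L\<^esub> v |u v. u \<in> U \<and> v \<in> V})\<rparr>"

lemma carrier_frame_cover [simp]: "carrier (frame_cover L) = carrier L"
  by (simp add: frame_cover_def)

lemma (in frame) saturation_frame_cover:
  "U \<subseteq> carrier L \<Longrightarrow> saturation (frame_cover L) U = down (\<Squnion>U)"
  by (auto simp: saturation_def frame_cover_def down_def)

lemma (in frame) frame_cover_conv:
  "U \<odot>\<^bsub>frame_cover L\<^esub> V = {u \<sqinter> v |u v. u \<in> U \<and> v \<in> V}"
  by (simp add: frame_cover_def)

lemma (in frame) basic_cover_frame_cover: "basic_cover (frame_cover L)"
proof
  fix U V a
  assume "U \<subseteq> carrier (frame_cover L)" "V \<subseteq> carrier (frame_cover L)" "a \<lhd>\<^bsub>frame_cover L\<^esub> U"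
    "set_cov (frame_cover L) U V"
  then have c: "U \<subseteq> carrier L" "V \<subseteq> carrier L" "a \<in> carrier L" "a \<sqsubseteq> \<Squnion>U" "\<Squnion>U \<sqsubseteq> \<Squnion>V"
    by (auto simp: frame_cover_def set_cov_def Join_le_iff)
  then have "a \<sqsubseteq> \<Squnion>V" using le_trans[of a "\<Squnion>U" "\<Squnion>V"] by simp
  then show "a \<lhd>\<^bsub>frame_cover L\<^esub> V"
    using c by (simp add: frame_cover_def)
qed (auto simp: frame_cover_def sup_upper)

text \<open>
  Saturation sends \<open>U\<close> to the principal ideal of \<open>\<Squnion>U\<close>, and by the frame law the pointwise meet of
  two subsets has the meet of their joins as its join. So the operation on subsets induces
  intersection of principal ideals, and all axioms follow from properties of intersection.
\<close>

lemma (in frame) formal_cover_frame_cover: "formal_cover (frame_cover L)"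
proof -
  interpret S: basic_cover "frame_cover L" by (rule basic_cover_frame_cover)
  let ?S = "frame_cover L"
  have conv_closed: "U \<odot>\<^bsub>?S\<^esub> V \<subseteq> carrier L" if "U \<subseteq> carrier L" "V \<subseteq> carrier L" for U V
    using that by (auto simp: frame_cover_conv intro!: meet_closed)
  have sat: "saturation ?S (U \<odot>\<^bsub>?S\<^esub> V) = saturation ?S U \<inter> saturation ?S V"
    if "U \<subseteq> carrier L" "V \<subseteq> carrier L" for U V
    using that conv_closed[OF that]
    by (simp add: saturation_frame_cover down_meet[symmetric])
      (simp add: frame_cover_conv Join_pointwise_meet)
  have comm: "U \<odot>\<^bsub>?S\<^esub> V = V \<odot>\<^bsub>?S\<^esub> U" for U V
    unfolding frame_cover_conv by (rule Collect_cong) (metis meet_comm)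
  have set_cov: "set_cov ?S U V \<longleftrightarrow> saturation ?S U \<subseteq> saturation ?S V"
    if "U \<subseteq> carrier L" "V \<subseteq> carrier L" for U V
    using that S.set_cov_iff S.saturation_least[of V U] S.saturation_extensive[of U] by auto
  have distrib: "sat_conv ?S U (sat_Join ?S \<V>) = sat_Join ?S ((\<lambda>V. sat_conv ?S U V) ` \<V>)"
    if "U \<in> Sat ?S" "\<V> \<subseteq> Sat ?S" for U \<V>
  proof -
    have U: "U \<subseteq> carrier L" "saturation ?S U = U" and V: "\<And>V. V \<in> \<V> \<Longrightarrow> V \<subseteq> carrier L"
      using that by (auto simp: Sat_def)
    have "sat_conv ?S U (sat_Join ?S \<V>) = saturation ?S U \<inter> saturation ?S (\<Union>\<V>)"
      using U V S.saturation_subset[of "\<Union>\<V>"] S.saturation_idem[of "\<Union>\<V>"]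
      by (simp add: sat_conv_def sat_Join_def sat Union_least)
    also have "\<dots> = saturation ?S (U \<odot>\<^bsub>?S\<^esub> \<Union>\<V>)"
      using U V by (simp add: sat Union_least)
    also have "U \<odot>\<^bsub>?S\<^esub> \<Union>\<V> = (\<Union>V\<in>\<V>. U \<odot>\<^bsub>?S\<^esub> V)"
      by (auto simp: frame_cover_conv)
    also have "saturation ?S \<dots> = sat_Join ?S ((\<lambda>V. sat_conv ?S U V) ` \<V>)"
      unfolding sat_Join_def sat_conv_def using U V conv_closed
      by (intro S.saturation_UN[symmetric]) simp
    finally show ?thesis .
  qed
  show ?thesis
  proof unfold_locales
    fix U V W assume "U \<subseteq> carrier ?S" "V \<subseteq> carrier ?S" "W \<subseteq> carrier ?S"
    then show "set_cov ?S (U \<odot>\<^bsub>?S\<^esub> V \<odot>\<^bsub>?S\<^esub> W) (U \<odot>\<^bsub>?S\<^esub> (V \<odot>\<^bsub>?S\<^esub> W))"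
      by (simp add: set_cov conv_closed sat Int_assoc)
  next
    fix U\<^sub>1 V\<^sub>1 U\<^sub>2 V\<^sub>2
    assume "U\<^sub>1 \<subseteq> carrier ?S" "V\<^sub>1 \<subseteq> carrier ?S" "U\<^sub>2 \<subseteq> carrier ?S" "V\<^sub>2 \<subseteq> carrier ?S"
      "set_cov ?S U\<^sub>1 V\<^sub>1" "set_cov ?S U\<^sub>2 V\<^sub>2"
    then show "set_cov ?S (U\<^sub>1 \<odot>\<^bsub>?S\<^esub> U\<^sub>2) (V\<^sub>1 \<odot>\<^bsub>?S\<^esub> V\<^sub>2)"
      by (auto simp add: set_cov conv_closed sat)
  next
    fix U V assume "U \<subseteq> carrier ?S" "V \<subseteq> carrier ?S"
    then show "set_cov ?S (U \<odot>\<^bsub>?S\<^esub> V) (V \<odot>\<^bsub>?S\<^esub> U)"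
      by (auto simp add: set_cov conv_closed sat)
  next
    fix U \<V> assume UV: "U \<in> Sat ?S" "\<V> \<subseteq> Sat ?S"
    show "sat_conv ?S U (sat_Join ?S \<V>) = sat_Join ?S ((\<lambda>V. sat_conv ?S U V) ` \<V>)"
      by (rule distrib[OF UV])
    then show "sat_conv ?S (sat_Join ?S \<V>) U = sat_Join ?S ((\<lambda>V. sat_conv ?S V U) ` \<V>)"
      by (simp add: sat_conv_def comm)
  qed (simp_all add: conv_closed sat)
qed

lemma frame_homD:
  assumes "f \<in> frame_hom L M"
  shows "f \<in> carrier L \<rightarrow>\<^sub>E carrier M"
    and "A \<subseteq> carrier L \<Longrightarrow> f (\<Squnion>\<^bsub>L\<^esub>A) = \<Squnion>\<^bsub>M\<^esub>(f ` A)"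
    and "\<lbrakk>x \<in> carrier L; y \<in> carrier L\<rbrakk> \<Longrightarrow> f (x \<sqinter>\<^bsub>L\<^esub> y) = f x \<sqinter>\<^bsub>M\<^esub> f y"
    and "f \<top>\<^bsub>L\<^esub> = \<top>\<^bsub>M\<^esub>"
    and "x \<in> carrier L \<Longrightarrow> f x \<in> carrier M"
  using assms by (auto simp: frame_hom_def sup_pres_def meet_pres_def)

lemma frame_homI:
  assumes "frame L" "frame M" "f \<in> carrier L \<rightarrow>\<^sub>E carrier M"
    and "\<And>A. A \<subseteq> carrier L \<Longrightarrow> f (\<Squnion>\<^bsub>L\<^esub>A) = \<Squnion>\<^bsub>M\<^esub>(f ` A)"
    and "\<And>x y. \<lbrakk>x \<in> carrier L; y \<in> carrier L\<rbrakk> \<Longrightarrow> f (x \<sqinter>\<^bsub>L\<^esub> y) = f x \<sqinter>\<^bsub>M\<^esub> f y"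
    and "f \<top>\<^bsub>L\<^esub> = \<top>\<^bsub>M\<^esub>"
  shows "f \<in> frame_hom L M"
  using assms by (auto simp: frame_hom_def sup_pres_def meet_pres_def frame_def)

lemma frame_hom_compose:
  assumes L: "frame L" and M: "frame M" and N: "frame N"
    and f: "f \<in> frame_hom L M" and g: "g \<in> frame_hom M N"
  shows "compose (carrier L) g f \<in> frame_hom L N"
proof -
  interpret L: frame L by fact
  show ?thesis
  proof (rule frame_homI[OF L N])
    show "compose (carrier L) g f \<in> carrier L \<rightarrow>\<^sub>E carrier N"
      using frame_homD(1)[OF f] frame_homD(1)[OF g] by (auto simp: compose_def)
    fix A assume A: "A \<subseteq> carrier L"
    then have "f ` A \<subseteq> carrier M" using frame_homD(5)[OF f] by auto
    moreover have "g ` f ` A = compose (carrier L) g f ` A"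
      unfolding image_image using A by (intro image_cong) (auto simp: compose_def)
    ultimately show "compose (carrier L) g f (\<Squnion>\<^bsub>L\<^esub>A) = \<Squnion>\<^bsub>N\<^esub>(compose (carrier L) g f ` A)"
      using A by (simp add: frame_homD(2)[OF f] frame_homD(2)[OF g] compose_eq)
  qed (simp_all add: compose_eq frame_homD(3-5)[OF f] frame_homD(3-5)[OF g])
qed

lemma frame_hom_idt:
  assumes "frame L"
  shows "(\<lambda>x \<in> carrier L. x) \<in> frame_hom L L"
proof -
  interpret frame L by fact
  have "(\<lambda>x \<in> carrier L. x) ` A = A" if "A \<subseteq> carrier L" for A
    using that by force
  then show ?thesis
    by (intro frame_homI[OF assms assms]) auto
qed

lemma category_Frm: "category (Frm small)"
proof
  fix L M N P f g h
  assume "f \<in> hom_set (Frm small) L M" "g \<in> hom_set (Frm small) M N" "h \<in> hom_set (Frm small) N P"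
  then show "cmp (Frm small) L N P h (cmp (Frm small) L M N g f)
      = cmp (Frm small) L M P (cmp (Frm small) M N P h g) f"
    by (auto simp: Frm_def compose_def fun_eq_iff frame_homD(5))
next
  fix L M f assume f: "f \<in> hom_set (Frm small) L M"
  then have "f \<in> extensional (carrier L)" "f \<in> carrier L \<rightarrow> carrier M"
    using frame_homD(1)[of f L M] by (auto simp: Frm_def PiE_def)
  then show "cmp (Frm small) L L M f (idt (Frm small) L) = f"
    and "cmp (Frm small) L M M (idt (Frm small) M) f = f"
    by (simp_all add: Frm_def compose_Id Id_compose)
qed (auto simp: Frm_def frame_hom_idt frame_hom_compose)

text \<open>
  A frame map from \<open>L\<close> to \<open>M\<close> becomes a relation from the points of \<open>M\<close> to the points of \<open>L\<close>, so
  the direction is reversed.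
\<close>

definition frame_hom_rel ::
  "('a, 'x) gorder_scheme \<Rightarrow> ('b, 'y) gorder_scheme \<Rightarrow> ('a \<Rightarrow> 'b) \<Rightarrow> ('b \<times> 'a) set" where
  "frame_hom_rel L M f = {(b, a). b \<in> carrier M \<and> a \<in> carrier L \<and> b \<sqsubseteq>\<^bsub>M\<^esub> f a}"

text \<open>
  On principal ideals the relation acts as the frame map does on their generators. This
  identity carries functoriality and faithfulness below.
\<close>

lemma sat_preimage_frame_hom_rel:
  assumes L: "frame L" and M: "frame M" and f: "f \<in> frame_hom L M" and V: "V \<subseteq> carrier L"
  shows "sat_preimage (frame_cover M) (frame_hom_rel L M f) V = frame.down M (f (\<Squnion>\<^bsub>L\<^esub>V))"
proof -
  interpret M: frame M by fact
  have fc: "f a \<in> carrier M" if "a \<in> V" for a using V that frame_homD(5)[OF f] by auto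
  have "(frame_hom_rel L M f)\<inverse> `` V = (\<Union>a\<in>V. M.down (f a))"
    using V by (auto simp: frame_hom_rel_def M.down_def)
  moreover have "\<Squnion>\<^bsub>M\<^esub>(\<Union>a\<in>V. M.down (f a)) = \<Squnion>\<^bsub>M\<^esub>((\<lambda>a. \<Squnion>\<^bsub>M\<^esub>(M.down (f a))) ` V)"
    by (intro M.Join_UN) (auto simp: M.down_def)
  moreover have "(\<lambda>a. \<Squnion>\<^bsub>M\<^esub>(M.down (f a))) ` V = f ` V"
    using fc by (intro image_cong) (auto simp: M.Join_down)
  moreover have "(\<Union>a\<in>V. M.down (f a)) \<subseteq> carrier M" by (auto simp: M.down_def)
  ultimately show ?thesis
    by (simp add: sat_preimage_def M.saturation_frame_cover frame_homD(2)[OF f V])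
qed

lemma formal_cover_map_frame_hom_rel:
  assumes L: "frame L" and M: "frame M" and f: "f \<in> frame_hom L M"
  shows "formal_cover_map (frame_cover M) (frame_cover L) (frame_hom_rel L M f)"
proof -
  interpret L: frame L by fact
  interpret M: frame M by fact
  note pre = sat_preimage_frame_hom_rel[OF L M f]
  have down: "L.down x \<subseteq> carrier L" for x by (auto simp: L.down_def)
  have "L.down (\<Squnion>\<^bsub>L\<^esub>U) \<inter> L.down (\<Squnion>\<^bsub>L\<^esub>V) = L.down (\<Squnion>\<^bsub>L\<^esub>U \<sqinter>\<^bsub>L\<^esub> \<Squnion>\<^bsub>L\<^esub>V)"
    if "U \<subseteq> carrier L" "V \<subseteq> carrier L" for U V
    using that by (simp add: L.down_meet)
  moreover have "M.down \<top>\<^bsub>M\<^esub> = carrier M" by (auto simp: M.down_def)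
  ultimately show ?thesis
    unfolding formal_cover_map_iff[OF M.formal_cover_frame_cover L.formal_cover_frame_cover]
    by (auto simp: pre down L.saturation_frame_cover L.Join_down L.Join_carrier frame_homD(3-5)[OF f]
        simp flip: M.down_meet)
      (auto simp: frame_hom_rel_def)
qed

definition frame_cover_functor ::
  "('u gorder, 'u \<Rightarrow> 'u, 'u conv_struct, ('u \<times> 'u) set set) ftor" where
  "frame_cover_functor =
     \<lparr>on_obj = frame_cover,
      on_hom = (\<lambda>M L f. cover_map_class (frame_cover M) (frame_cover L) (frame_hom_rel L M f))\<rparr>"

lemma cover_map_class_frame_hom_rel_iff:
  assumes L: "frame L" and M: "frame M" and f: "f \<in> frame_hom L M"
    and r: "formal_cover_map (frame_cover M) (frame_cover L) r"
  shows "cover_map_class (frame_cover M) (frame_cover L) (frame_hom_rel L M f)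
       = cover_map_class (frame_cover M) (frame_cover L) r \<longleftrightarrow>
    (\<forall>V. V \<subseteq> carrier L \<longrightarrow> sat_preimage (frame_cover M) r V = frame.down M (f (\<Squnion>\<^bsub>L\<^esub>V)))"
  using cover_map_class_eq_iff[OF frame.formal_cover_frame_cover[OF M]
      frame.formal_cover_frame_cover[OF L] formal_cover_map_frame_hom_rel[OF L M f] r]
  by (auto simp: sat_preimage_frame_hom_rel[OF L M f])

lemma frame_cover_functor: "cat_functor (opposite (Frm small)) (FCov small) frame_cover_functor"
proof -
  interpret Op: category "opposite (Frm small)"
    by (rule category.category_opposite[OF category_Frm])
  interpret FCov: category "FCov small" by (rule category_FCov)
  note [simp] = opposite_def Frm_def frame_cover_functor_def obj_FCov hom_set_FCov_iff idt_FCov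
  show ?thesis
  proof
    fix L assume "L \<in> obj (opposite (Frm small))"
    then show "on_obj frame_cover_functor L \<in> obj (FCov small)"
      by (simp add: frame.formal_cover_frame_cover)
  next
    fix M L f assume "M \<in> obj (opposite (Frm small))" "L \<in> obj (opposite (Frm small))"
      "f \<in> hom_set (opposite (Frm small)) M L"
    then show "on_hom frame_cover_functor M L f
      \<in> hom_set (FCov small) (on_obj frame_cover_functor M) (on_obj frame_cover_functor L)"
      using formal_cover_map_frame_hom_rel by auto
  next
    fix L assume "L \<in> obj (opposite (Frm small))"
    then have L: "frame L" by simp
    interpret frame L by (rule L)
    have "cover_map_class (frame_cover L) (frame_cover L) (frame_hom_rel L L (\<lambda>x \<in> carrier L. x))
        = cover_map_class (frame_cover L) (frame_cover L) (Id_on (carrier (frame_cover L)))"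
      by (subst cover_map_class_frame_hom_rel_iff[OF L L frame_hom_idt[OF L]
            formal_cover_map_Id_on[OF formal_cover_frame_cover]])
        (use sat_preimage_Id_on[of _ "frame_cover L"] in \<open>simp add: saturation_frame_cover\<close>)
    then show "on_hom frame_cover_functor L L (idt (opposite (Frm small)) L)
        = idt (FCov small) (on_obj frame_cover_functor L)"
      by simp
  next
    fix N M L g f
    assume "N \<in> obj (opposite (Frm small))" "M \<in> obj (opposite (Frm small))"
      "L \<in> obj (opposite (Frm small))"
      and hom: "g \<in> hom_set (opposite (Frm small)) N M" "f \<in> hom_set (opposite (Frm small)) M L"
    then have L: "frame L" and M: "frame M" and N: "frame N"
      and f: "f \<in> frame_hom L M" and g: "g \<in> frame_hom M N" by simp_all
    interpret L: frame L by fact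
    interpret M: frame M by fact
    interpret N: frame N by fact
    note maps = N.formal_cover_frame_cover M.formal_cover_frame_cover L.formal_cover_frame_cover
      formal_cover_map_frame_hom_rel[OF M N g] formal_cover_map_frame_hom_rel[OF L M f]
    have sub: "frame_hom_rel L M f \<subseteq> carrier (frame_cover M) \<times> carrier L"
      by (auto simp: frame_hom_rel_def)
    have "sat_preimage (frame_cover N) (frame_hom_rel M N g O frame_hom_rel L M f) V
        = N.down (compose (carrier L) g f (\<Squnion>\<^bsub>L\<^esub>V))" if V: "V \<subseteq> carrier L" for V
    proof -
      have "M.down (f (\<Squnion>\<^bsub>L\<^esub>V)) \<subseteq> carrier M" by (auto simp: M.down_def)
      then show ?thesis
        using V sat_preimage_relcomp[OF maps(1,2,4) sub]
        by (simp add: sat_preimage_frame_hom_rel[OF L M f V] sat_preimage_frame_hom_rel[OF M N g]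
            M.Join_down frame_homD(5)[OF f] compose_eq)
    qed
    then have "cover_map_class (frame_cover N) (frame_cover L)
          (frame_hom_rel L N (compose (carrier L) g f))
        = cover_map_class (frame_cover N) (frame_cover L) (frame_hom_rel M N g O frame_hom_rel L M f)"
      using cover_map_class_frame_hom_rel_iff[OF L N frame_hom_compose[OF L M N f g]
          formal_cover_map_relcomp[OF maps]] by simp
    then show "on_hom frame_cover_functor N L (cmp (opposite (Frm small)) N M L f g)
        = cmp (FCov small) (on_obj frame_cover_functor N) (on_obj frame_cover_functor M)
            (on_obj frame_cover_functor L) (on_hom frame_cover_functor M L f)
            (on_hom frame_cover_functor N M g)"
      by (simp add: cmp_FCov[OF maps])
  qed
qed

text \<open>
  The class of a cover map \<open>r\<close> is determined by the joins of the inverse images of points,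
  \<open>f x = \<Squnion>(r\<inverse> `` {x})\<close>. For \<open>r\<close> coming from a frame map this recovers the frame map, which gives
  faithfulness. For an arbitrary \<open>r\<close> the function \<open>f\<close> is a frame map because the action of \<open>r\<close>
  preserves joins, intersections and the top, and \<open>f\<close> has the same action as \<open>r\<close>, which gives
  fullness.
\<close>

lemma fully_faithful_frame_cover_functor:
  "fully_faithful_functor (opposite (Frm small)) (FCov small) frame_cover_functor"
proof -
  interpret cat_functor "opposite (Frm small)" "FCov small" frame_cover_functor
    by (rule frame_cover_functor)
  show ?thesis
  proof (unfold_locales, unfold bij_betw_def, intro conjI equalityI)
    fix M L :: "'a gorder"
    assume M': "M \<in> obj (opposite (Frm small))" and L': "L \<in> obj (opposite (Frm small))"
    then have M: "frame M" and L: "frame L" by (simp_all add: opposite_def Frm_def)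
    interpret L: frame L by fact
    interpret M: frame M by fact
    have hom: "hom_set (opposite (Frm small)) M L = frame_hom L M"
      by (simp add: opposite_def Frm_def)
    show "on_hom frame_cover_functor M L ` hom_set (opposite (Frm small)) M L
        \<subseteq> hom_set (FCov small) (on_obj frame_cover_functor M) (on_obj frame_cover_functor L)"
      using on_hom_closed[OF M' L'] by blast
    show "inj_on (on_hom frame_cover_functor M L) (hom_set (opposite (Frm small)) M L)"
    proof (rule inj_onI, unfold hom)
      fix f g assume f: "f \<in> frame_hom L M" and g: "g \<in> frame_hom L M"
        and eq: "on_hom frame_cover_functor M L f = on_hom frame_cover_functor M L g"
      have "M.down (f x) = M.down (g x)" if "x \<in> carrier L" for x
        using eq[unfolded frame_cover_functor_def ftor.simps
            cover_map_class_frame_hom_rel_iff[OF L M f formal_cover_map_frame_hom_rel[OF L M g]],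
            rule_format, of "{x}"] that
        by (simp add: sat_preimage_frame_hom_rel[OF L M g])
      then have "f x = g x" if "x \<in> carrier L" for x
        using that by (simp add: M.down_inject frame_homD(5)[OF f] frame_homD(5)[OF g])
      then show "f = g"
        using frame_homD(1)[OF f] frame_homD(1)[OF g] by (rule PiE_ext[rotated 2])
    qed
    show "hom_set (FCov small) (on_obj frame_cover_functor M) (on_obj frame_cover_functor L)
        \<subseteq> on_hom frame_cover_functor M L ` hom_set (opposite (Frm small)) M L"
    proof
      fix \<rho> assume "\<rho> \<in> hom_set (FCov small) (on_obj frame_cover_functor M) (on_obj frame_cover_functor L)"
      then obtain r where r: "formal_cover_map (frame_cover M) (frame_cover L) r"
        and \<rho>: "\<rho> = cover_map_class (frame_cover M) (frame_cover L) r"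
        by (auto simp: hom_set_FCov_iff frame_cover_functor_def)
      let ?pre = "sat_preimage (frame_cover M) r"
      note r' = r[unfolded formal_cover_map_iff[OF M.formal_cover_frame_cover
            L.formal_cover_frame_cover], simplified]
      define f where "f = (\<lambda>x \<in> carrier L. \<Squnion>\<^bsub>M\<^esub>(r\<inverse> `` {x}))"
      have dom: "r\<inverse> `` V \<subseteq> carrier M" for V using r' by auto
      have fc: "f x \<in> carrier M" if "x \<in> carrier L" for x
        using that dom by (simp add: f_def)
      have "?pre V = M.down (\<Squnion>\<^bsub>M\<^esub>(f ` V))" if V: "V \<subseteq> carrier L" for V
      proof -
        have "r\<inverse> `` V = (\<Union>x\<in>V. r\<inverse> `` {x})" by auto
        then have "\<Squnion>\<^bsub>M\<^esub>(r\<inverse> `` V) = \<Squnion>\<^bsub>M\<^esub>((\<lambda>x. \<Squnion>\<^bsub>M\<^esub>(r\<inverse> `` {x})) ` V)"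
          using M.Join_UN[of V "\<lambda>x. r\<inverse> `` {x}"] dom by simp
        also have "(\<lambda>x. \<Squnion>\<^bsub>M\<^esub>(r\<inverse> `` {x})) ` V = f ` V"
          using V by (intro image_cong) (auto simp: f_def)
        finally show ?thesis
          using dom by (simp add: sat_preimage_def M.saturation_frame_cover)
      qed
      moreover have pre_singleton: "?pre {x} = M.down (f x)" if "x \<in> carrier L" for x
        using that dom by (simp add: sat_preimage_def M.saturation_frame_cover f_def)
      \<comment> \<open>A subset of \<open>L\<close> and its join have the same saturation.\<close>
      moreover have pre_Join: "?pre {\<Squnion>\<^bsub>L\<^esub>V} = ?pre V" if V: "V \<subseteq> carrier L" for V
        using r' V L.saturation_frame_cover[OF V] L.saturation_frame_cover[of "{\<Squnion>\<^bsub>L\<^esub>V}"]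
          L.sup_of_singleton[of "\<Squnion>\<^bsub>L\<^esub>V"]
        by (metis L.sup_closed empty_subsetI insert_subset)
      ultimately have "M.down (f (\<Squnion>\<^bsub>L\<^esub>V)) = M.down (\<Squnion>\<^bsub>M\<^esub>(f ` V))" if "V \<subseteq> carrier L" for V
        using that by (metis L.sup_closed)
      then have f_Join: "f (\<Squnion>\<^bsub>L\<^esub>V) = \<Squnion>\<^bsub>M\<^esub>(f ` V)" if V: "V \<subseteq> carrier L" for V
        using V fc by (intro M.down_inject[THEN iffD1] M.sup_closed) auto
      have "f \<in> frame_hom L M"
      proof (rule frame_homI[OF L M])
        show "f \<in> carrier L \<rightarrow>\<^sub>E carrier M" using fc by (auto simp: f_def)
        show "f (\<Squnion>\<^bsub>L\<^esub>A) = \<Squnion>\<^bsub>M\<^esub>(f ` A)" if "A \<subseteq> carrier L" for A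
          by (rule f_Join[OF that])
        show "f (x \<sqinter>\<^bsub>L\<^esub> y) = f x \<sqinter>\<^bsub>M\<^esub> f y" if x: "x \<in> carrier L" and y: "y \<in> carrier L" for x y
        proof -
          have "L.down (x \<sqinter>\<^bsub>L\<^esub> y) = saturation (frame_cover L) {x} \<inter> saturation (frame_cover L) {y}"
            using x y by (simp add: L.saturation_frame_cover L.down_meet)
          then have "?pre (L.down (x \<sqinter>\<^bsub>L\<^esub> y)) = ?pre {x} \<inter> ?pre {y}"
            using r' x y by simp
          moreover have "?pre (L.down (x \<sqinter>\<^bsub>L\<^esub> y)) = ?pre {x \<sqinter>\<^bsub>L\<^esub> y}"
            using x y pre_Join[of "L.down (x \<sqinter>\<^bsub>L\<^esub> y)"]
            by (simp add: L.Join_down) (simp add: L.down_def)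
          ultimately show ?thesis
            using x y fc by (simp add: pre_singleton M.down_meet[symmetric] M.down_inject)
        qed
        have "M.down (f \<top>\<^bsub>L\<^esub>) = carrier M"
          using r' pre_Join[of "carrier L"] pre_singleton[of "\<top>\<^bsub>L\<^esub>"]
          by (simp add: L.Join_carrier)
        also have "\<dots> = M.down \<top>\<^bsub>M\<^esub>" by (auto simp: M.down_def)
        finally show "f \<top>\<^bsub>L\<^esub> = \<top>\<^bsub>M\<^esub>" using fc by (simp add: M.down_inject)
      qed
      moreover have "cover_map_class (frame_cover M) (frame_cover L) (frame_hom_rel L M f) = \<rho>"
        unfolding \<rho> cover_map_class_frame_hom_rel_iff[OF L M \<open>f \<in> frame_hom L M\<close> r]
        using pre_Join pre_singleton by (metis L.sup_closed)
      ultimately show "\<rho> \<in> on_hom frame_cover_functor M L ` hom_set (opposite (Frm small)) M L"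
        unfolding hom by (auto simp: frame_cover_functor_def)
    qed
  qed
qed

section \<open>Every formal cover comes from a frame\<close>
text \<open>
  The frame of saturated subsets of \<open>S\<close>, transported along an injection \<open>e\<close>. The transport is
  needed because the points of a formal cover and the elements of a frame have to live in the same
  universe, whereas saturated subsets are one level higher.
\<close>

definition encoded_Sat :: "('a set \<Rightarrow> 'b) \<Rightarrow> ('a, 'x) cover_struct_scheme \<Rightarrow> 'b gorder" where
  "encoded_Sat e S =
     \<lparr>carrier = e ` Sat S, eq = (=),
      le = (\<lambda>x y. inv_into (Sat S) e x \<subseteq> inv_into (Sat S) e y)\<rparr>"

locale encoded_formal_cover = formal_cover S
  for S :: "('a, 'x) conv_struct_scheme" (structure) +
  fixes e :: "'a set \<Rightarrow> 'b"
  assumes inj_encode: "inj_on e (Sat S)"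
begin

abbreviation L :: "'b gorder" where "L \<equiv> encoded_Sat e S"

abbreviation decode :: "'b \<Rightarrow> 'a set" where "decode \<equiv> inv_into (Sat S) e"

lemma carrier_L: "carrier L = e ` Sat S" and le_L: "x \<sqsubseteq>\<^bsub>L\<^esub> y \<longleftrightarrow> decode x \<subseteq> decode y"
  and eq_L: "(.=\<^bsub>L\<^esub>) = (=)"
  by (simp_all add: encoded_Sat_def)

lemma decode_encode [simp]: "U \<in> Sat S \<Longrightarrow> decode (e U) = U"
  using inj_encode by simp

lemma encode_closed [simp]: "U \<in> Sat S \<Longrightarrow> e U \<in> carrier L"
  by (simp add: carrier_L)

lemma decode_closed [simp]: "x \<in> carrier L \<Longrightarrow> decode x \<in> Sat S"
  by (auto simp: carrier_L)

lemma decode_subset: "x \<in> carrier L \<Longrightarrow> decode x \<subseteq> carrier S"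
  by (rule Sat_subset[OF decode_closed])

lemma encode_decode [simp]: "x \<in> carrier L \<Longrightarrow> e (decode x) = x"
  by (auto simp: carrier_L)

lemma decode_inject: "\<lbrakk>x \<in> carrier L; y \<in> carrier L\<rbrakk> \<Longrightarrow> decode x = decode y \<longleftrightarrow> x = y"
  by (metis encode_decode)

lemma saturation_Sat: "U \<in> Sat S \<Longrightarrow> saturation S U = U"
  by (simp add: Sat_def)

lemma sat_Join_closed: "\<V> \<subseteq> Sat S \<Longrightarrow> sat_Join S \<V> \<in> Sat S"
  unfolding sat_Join_def by (intro saturation_in_Sat) (auto dest: Sat_subset)

text \<open>
  Intersecting with the carrier gives the empty family the top element as its meet.
\<close>

lemma Sat_Inter: "\<V> \<subseteq> Sat S \<Longrightarrow> carrier S \<inter> \<Inter>\<V> \<in> Sat S"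
proof -
  assume \<V>: "\<V> \<subseteq> Sat S"
  have "saturation S (carrier S \<inter> \<Inter>\<V>) \<subseteq> V" if "V \<in> \<V>" for V
  proof -
    have "V \<in> Sat S" using \<V> that by blast
    then show ?thesis
      using saturation_mono[of "carrier S \<inter> \<Inter>\<V>" V] that
      by (auto simp: saturation_Sat dest: Sat_subset)
  qed
  then have "saturation S (carrier S \<inter> \<Inter>\<V>) = carrier S \<inter> \<Inter>\<V>"
    using saturation_subset[of "carrier S \<inter> \<Inter>\<V>"] saturation_extensive[of "carrier S \<inter> \<Inter>\<V>"]
    by blast
  then show ?thesis by (simp add: Sat_def)
qed

lemma is_lub_sat_Join:
  assumes "A \<subseteq> carrier L"
  shows "is_lub L (e (sat_Join S (decode ` A))) A"
proof -
  have dA: "decode ` A \<subseteq> Sat S" using assms by auto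
  note closed = sat_Join_closed[OF dA]
  show ?thesis
  proof (rule least_UpperI)
    fix x assume x: "x \<in> A"
    have "\<Union>(decode ` A) \<subseteq> carrier S" using assms decode_subset by blast
    then have "decode x \<subseteq> sat_Join S (decode ` A)"
      unfolding sat_Join_def using saturation_extensive x by blast
    then show "x \<sqsubseteq>\<^bsub>L\<^esub> e (sat_Join S (decode ` A))" by (simp add: le_L closed)
  next
    fix y assume y: "y \<in> Upper L A"
    then have yc: "y \<in> carrier L" and "\<Union>(decode ` A) \<subseteq> decode y"
      using assms by (auto simp: Upper_def le_L)
    then have "sat_Join S (decode ` A) \<subseteq> saturation S (decode y)"
      unfolding sat_Join_def by (intro saturation_mono decode_subset)
    then show "e (sat_Join S (decode ` A)) \<sqsubseteq>\<^bsub>L\<^esub> y"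
      by (simp add: le_L closed yc saturation_Sat)
  qed (simp_all add: assms closed)
qed

lemma is_glb_Inter:
  assumes "A \<subseteq> carrier L"
  shows "is_glb L (e (carrier S \<inter> \<Inter>(decode ` A))) A"
proof -
  have dA: "decode ` A \<subseteq> Sat S" using assms by auto
  note closed = Sat_Inter[OF dA]
  show ?thesis
  proof (rule greatest_LowerI)
    fix y assume "y \<in> Lower L A"
    then have "y \<in> carrier L" "\<And>x. x \<in> A \<Longrightarrow> decode y \<subseteq> decode x"
      using assms by (auto simp: Lower_def le_L)
    then have "decode y \<subseteq> carrier S \<inter> \<Inter>(decode ` A)" using decode_subset by blast
    then show "y \<sqsubseteq>\<^bsub>L\<^esub> e (carrier S \<inter> \<Inter>(decode ` A))" by (simp add: le_L closed)
  qed (auto simp: assms closed le_L)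
qed

sublocale L: complete_lattice L
proof
  fix A assume "A \<subseteq> carrier L"
  then show "\<exists>s. is_lub L s A" and "\<exists>i. is_glb L i A"
    using is_lub_sat_Join is_glb_Inter by blast+
qed (use decode_inject in \<open>auto simp: le_L eq_L\<close>)

lemma decode_Join: "A \<subseteq> carrier L \<Longrightarrow> decode (\<Squnion>\<^bsub>L\<^esub>A) = sat_Join S (decode ` A)"
proof -
  assume A: "A \<subseteq> carrier L"
  have "\<Squnion>\<^bsub>L\<^esub>A = e (sat_Join S (decode ` A))"
    using L.least_unique[OF L.sup_lub[OF A] is_lub_sat_Join[OF A]] .
  moreover have "decode ` A \<subseteq> Sat S" using A by auto
  ultimately show ?thesis by (simp add: sat_Join_closed)
qed

lemma decode_meet: "\<lbrakk>x \<in> carrier L; y \<in> carrier L\<rbrakk> \<Longrightarrow> decode (x \<sqinter>\<^bsub>L\<^esub> y) = decode x \<inter> decode y"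
proof -
  assume x: "x \<in> carrier L" and y: "y \<in> carrier L"
  then have xy: "{x, y} \<subseteq> carrier L" by simp
  have "x \<sqinter>\<^bsub>L\<^esub> y = e (carrier S \<inter> \<Inter>(decode ` {x, y}))"
    unfolding meet_def using L.greatest_unique[OF L.inf_glb[OF xy] is_glb_Inter[OF xy]] .
  moreover have "carrier S \<inter> \<Inter>(decode ` {x, y}) = decode x \<inter> decode y"
    using decode_subset[OF x] by auto
  moreover have "carrier S \<inter> \<Inter>(decode ` {x, y}) \<in> Sat S"
    using x y by (intro Sat_Inter) auto
  ultimately show ?thesis by simp
qed

sublocale L: frame L
proof
  fix x A assume x: "x \<in> carrier L" and A: "A \<subseteq> carrier L"
  have xA: "(\<lambda>a. x \<sqinter>\<^bsub>L\<^esub> a) ` A \<subseteq> carrier L" using x A by auto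
  have "decode (x \<sqinter>\<^bsub>L\<^esub> \<Squnion>\<^bsub>L\<^esub>A) = decode x \<inter> sat_Join S (decode ` A)"
    using x A by (simp add: decode_meet decode_Join)
  also have "\<dots> = sat_Join S ((\<lambda>V. decode x \<inter> V) ` decode ` A)"
    using x A by (intro Int_sat_Join) auto
  also have "(\<lambda>V. decode x \<inter> V) ` decode ` A = decode ` (\<lambda>a. x \<sqinter>\<^bsub>L\<^esub> a) ` A"
    unfolding image_image using x A by (intro image_cong refl) (auto simp: decode_meet)
  also have "sat_Join S \<dots> = decode (\<Squnion>\<^bsub>L\<^esub>((\<lambda>a. x \<sqinter>\<^bsub>L\<^esub> a) ` A))"
    using xA by (simp add: decode_Join)
  finally show "x \<sqinter>\<^bsub>L\<^esub> \<Squnion>\<^bsub>L\<^esub>A = \<Squnion>\<^bsub>L\<^esub>((\<lambda>a. x \<sqinter>\<^bsub>L\<^esub> a) ` A)"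
    using x A xA by (simp add: decode_inject)
qed

lemma down_L: "L.down x = {y \<in> carrier L. decode y \<subseteq> decode x}"
  by (simp add: L.down_def le_L)

text \<open>
  The two relations exhibit \<open>S\<close> as isomorphic to the cover of its frame of saturated subsets. A
  point \<open>a\<close> of \<open>S\<close> lies below a saturated subset when it is a member; a saturated subset lies below
  \<open>a\<close> when it is contained in the saturation of \<open>a\<close>. The actions send a family of saturated
  subsets to its join and a subset of \<open>S\<close> to the principal ideal of its saturation, and these are
  mutually inverse up to saturation.
\<close>

definition to_L :: "('a \<times> 'b) set" where
  "to_L = {(a, x). x \<in> carrier L \<and> a \<in> decode x}"

definition from_L :: "('b \<times> 'a) set" where
  "from_L = {(x, a). x \<in> carrier L \<and> a \<in> carrier S \<and> decode x \<subseteq> saturation S {a}}"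

lemma sat_preimage_to_L:
  assumes V: "V \<subseteq> carrier L"
  shows "sat_preimage S to_L V = decode (\<Squnion>\<^bsub>L\<^esub>V)"
proof -
  have "to_L\<inverse> `` V = \<Union>(decode ` V)" using V by (auto simp: to_L_def)
  then show ?thesis using V by (simp add: sat_preimage_def decode_Join sat_Join_def)
qed

lemma sat_preimage_from_L:
  assumes U: "U \<subseteq> carrier S"
  shows "sat_preimage (frame_cover L) from_L U = L.down (e (saturation S U))"
proof -
  have sat: "saturation S {a} \<in> Sat S" if "a \<in> U" for a
    using U that by (intro saturation_in_Sat) auto
  let ?E = "(\<lambda>a. e (saturation S {a})) ` U"
  have E: "?E \<subseteq> carrier L" using sat by auto
  have "from_L\<inverse> `` U = (\<Union>a\<in>U. L.down (e (saturation S {a})))"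
    using U by (auto simp: from_L_def down_L sat)
  then have "\<Squnion>\<^bsub>L\<^esub>(from_L\<inverse> `` U) = \<Squnion>\<^bsub>L\<^esub>((\<lambda>a. \<Squnion>\<^bsub>L\<^esub>(L.down (e (saturation S {a})))) ` U)"
    using L.Join_UN[of U "\<lambda>a. L.down (e (saturation S {a}))"] by (auto simp: L.down_def)
  also have "(\<lambda>a. \<Squnion>\<^bsub>L\<^esub>(L.down (e (saturation S {a})))) ` U = ?E"
    by (intro image_cong refl L.Join_down encode_closed sat)
  finally have Join: "\<Squnion>\<^bsub>L\<^esub>(from_L\<inverse> `` U) = \<Squnion>\<^bsub>L\<^esub>?E" .
  have "decode ` ?E = (\<lambda>a. saturation S {a}) ` U"
    unfolding image_image by (intro image_cong refl decode_encode sat)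
  then have "decode (\<Squnion>\<^bsub>L\<^esub>?E) = saturation S (\<Union>a\<in>U. saturation S {a})"
    using decode_Join[OF E] by (simp add: sat_Join_def)
  also have "\<dots> = saturation S U"
    using saturation_UN[of U "\<lambda>a. {a}"] U by auto
  finally have "\<Squnion>\<^bsub>L\<^esub>?E = e (saturation S U)"
    using encode_decode[OF L.sup_closed[OF E]] by simp
  moreover have "from_L\<inverse> `` U \<subseteq> carrier L" by (auto simp: from_L_def)
  ultimately show ?thesis
    using Join by (simp add: sat_preimage_def L.saturation_frame_cover)
qed

lemma carrier_in_Sat: "carrier S \<in> Sat S"
  by (simp add: Sat_def saturation_carrier)

lemma down_closed: "L.down x \<subseteq> carrier L"
  by (auto simp: L.down_def)

lemma formal_cover_map_to_L: "formal_cover_map S (frame_cover L) to_L"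
proof -
  have "to_L \<subseteq> carrier S \<times> carrier (frame_cover L)"
    using decode_subset by (auto simp: to_L_def)
  moreover have "sat_preimage S to_L (L.down x) = decode x" if "x \<in> carrier L" for x
    using that by (simp add: sat_preimage_to_L down_closed L.Join_down)
  moreover have "L.down x \<inter> L.down y = L.down (x \<sqinter>\<^bsub>L\<^esub> y)" if "x \<in> carrier L" "y \<in> carrier L" for x y
    using that by (simp add: L.down_meet)
  moreover have "decode (\<Squnion>\<^bsub>L\<^esub>(carrier L)) = carrier S"
  proof (rule equalityI)
    show "decode (\<Squnion>\<^bsub>L\<^esub>(carrier L)) \<subseteq> carrier S" by (intro decode_subset L.sup_closed subset_refl)
    show "carrier S \<subseteq> decode (\<Squnion>\<^bsub>L\<^esub>(carrier L))"
      using L.sup_upper[of "carrier L" "e (carrier S)"] carrier_in_Sat by (simp add: le_L)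
  qed
  ultimately show ?thesis
    unfolding formal_cover_map_iff[OF formal_cover_axioms L.formal_cover_frame_cover]
    by (simp add: L.saturation_frame_cover sat_preimage_to_L decode_meet)
qed

lemma formal_cover_map_from_L: "formal_cover_map (frame_cover L) S from_L"
proof -
  have "from_L \<subseteq> carrier (frame_cover L) \<times> carrier S"
    by (auto simp: from_L_def)
  moreover have "sat_preimage (frame_cover L) from_L (saturation S U \<inter> saturation S V)
      = L.down (e (saturation S U)) \<inter> L.down (e (saturation S V))"
    if "U \<subseteq> carrier S" "V \<subseteq> carrier S" for U V
  proof -
    have UV: "saturation S U \<inter> saturation S V \<in> Sat S"
      unfolding conv_inter[OF that, symmetric] by (rule saturation_in_Sat[OF conv_closed[OF that]])
    show ?thesis
      using Sat_subset[OF UV] that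
      by (auto simp: sat_preimage_from_L saturation_Sat[OF UV] down_L UV saturation_in_Sat)
  qed
  moreover have "L.down (e (carrier S)) = carrier L"
    using decode_subset by (auto simp: down_L carrier_in_Sat)
  ultimately show ?thesis
    unfolding formal_cover_map_iff[OF L.formal_cover_frame_cover formal_cover_axioms]
    by (simp add: sat_preimage_from_L saturation_subset saturation_idem saturation_carrier)
qed

lemma to_L_from_L: "cover_map_class S S (to_L O from_L) = cover_map_class S S (Id_on (carrier S))"
proof -
  note S = formal_cover_axioms and FL = L.formal_cover_frame_cover
  note to_L = formal_cover_map_to_L and from_L = formal_cover_map_from_L
  have "from_L \<subseteq> carrier (frame_cover L) \<times> carrier S"
    by (auto simp: from_L_def)
  then have "sat_preimage S (to_L O from_L) U = saturation S U" if "U \<subseteq> carrier S" for U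
    using that
    by (simp add: sat_preimage_relcomp[OF S FL to_L] sat_preimage_from_L sat_preimage_to_L down_closed
        L.Join_down saturation_in_Sat)
  then show ?thesis
    unfolding cover_map_class_eq_iff[OF S S formal_cover_map_relcomp[OF S FL S to_L from_L]
        formal_cover_map_Id_on[OF S]]
    by (simp add: sat_preimage_Id_on)
qed

lemma from_L_to_L:
  "cover_map_class (frame_cover L) (frame_cover L) (from_L O to_L)
   = cover_map_class (frame_cover L) (frame_cover L) (Id_on (carrier (frame_cover L)))"
proof -
  note S = formal_cover_axioms and FL = L.formal_cover_frame_cover
  note to_L = formal_cover_map_to_L and from_L = formal_cover_map_from_L
  have "to_L \<subseteq> carrier S \<times> carrier L"
    using decode_subset by (auto simp: to_L_def)
  then have "sat_preimage (frame_cover L) (from_L O to_L) V = saturation (frame_cover L) V"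
    if "V \<subseteq> carrier L" for V
    using that
    by (simp add: sat_preimage_relcomp[OF FL S from_L] sat_preimage_from_L sat_preimage_to_L
        decode_subset saturation_Sat L.saturation_frame_cover)
  then show ?thesis
    unfolding cover_map_class_eq_iff[OF FL FL formal_cover_map_relcomp[OF FL S FL from_L to_L]
        formal_cover_map_Id_on[OF FL]]
    by (metis carrier_frame_cover sat_preimage_Id_on)
qed

end

lemma isomorphism_frame_cover_Sat:
  assumes "encoded_formal_cover S e"
  shows "isomorphism (FCov small) S (frame_cover (encoded_Sat e S))
    (cover_map_class S (frame_cover (encoded_Sat e S)) (encoded_formal_cover.to_L S e))"
proof -
  interpret encoded_formal_cover S e by fact
  note S = formal_cover_axioms and FL = L.formal_cover_frame_cover
  note to_L = formal_cover_map_to_L and from_L = formal_cover_map_from_L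
  show ?thesis
    unfolding isomorphism_def idt_FCov
  proof (intro conjI bexI)
    show "cover_map_class S (frame_cover L) to_L \<in> hom_set (FCov small) S (frame_cover L)"
      and "cover_map_class (frame_cover L) S from_L \<in> hom_set (FCov small) (frame_cover L) S"
      using to_L from_L by (auto simp: hom_set_FCov_iff)
  qed (simp_all only: cmp_FCov[OF S FL S to_L from_L] cmp_FCov[OF FL S FL from_L to_L]
      to_L_from_L from_L_to_L)
qed

text \<open>
  Impredicativity enters here: the powerset of the carrier is in bijection
  with a small set, so the frame of saturated subsets has a small copy.
\<close>

lemma essentially_surjective_frame_cover_functor:
  assumes "powersets_are_small small" "S \<in> obj (FCov small)"
  shows "\<exists>L \<in> obj (opposite (Frm small)). \<exists>u.
    isomorphism (FCov small) S (on_obj frame_cover_functor L) u"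
proof -
  have S: "formal_cover S" and small: "small (carrier S)"
    using assms(2) by (simp_all add: obj_FCov)
  obtain B where B: "small B" "Pow (carrier S) \<approx> B"
    using assms(1) small unfolding powersets_are_small_def by blast
  then obtain e where e: "bij_betw e (Pow (carrier S)) B"
    unfolding eqpoll_def by blast
  have Sat: "Sat S \<subseteq> Pow (carrier S)" by (auto simp: Sat_def)
  interpret encoded_formal_cover S e
    using S bij_betw_imp_inj_on[OF e] Sat
    by (intro encoded_formal_cover.intro encoded_formal_cover_axioms.intro) (auto intro: inj_on_subset)
  have "carrier L \<subseteq> B"
    using Sat bij_betw_imp_surj_on[OF e] by (auto simp: carrier_L)
  then have "small (carrier L)"
    using assms(1) B(1) unfolding powersets_are_small_def by blast
  then have "L \<in> obj (opposite (Frm small))"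
    using L.frame_axioms by (simp add: opposite_def Frm_def)
  then show ?thesis
    using isomorphism_frame_cover_Sat[OF encoded_formal_cover_axioms]
    by (auto simp: frame_cover_functor_def)
qed

theorem proposition5p6:
  fixes small :: "'u set \<Rightarrow> bool"
  assumes "powersets_are_small small"
  shows "dual_categories (FCov small) (Frm small)
    \<and> equivalent_categories (FCov small) (Loc small)"
proof -
  interpret fully_faithful_functor "opposite (Frm small)" "FCov small" frame_cover_functor
    by (rule fully_faithful_frame_cover_functor)
  have "equivalent_categories (FCov small) (opposite (Frm small))"
    by (rule equivalent_if_essentially_surjective)
      (rule essentially_surjective_frame_cover_functor[OF assms])
  then show ?thesis by (simp add: dual_categories_def Loc_def)
qed

end
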